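(* Assume (A1) and (A2) below and let $T>0$, $(x_0,y_0)\in\mathcal D$. Let $\mathcal S_\ell$ be the set of absolutely continuous solutions $\Pi(\cdot)=(x(\cdot),y(\cdot),z(\cdot))$ on $[0,T]$ of the differential inclusion $$\dot\Pi\in F(\Pi):=\bigcup_{(u,v)\in U\times[0,1]}\begin{bmatrix} f(x,y,u)\\ g(x,y,u)\\ \max(g(x,y,u),0)\,\big(1-v\,\mathbb 1_{\mathbb R^+}(z-y)\big)\end{bmatrix},\qquad \Pi=(x,y,z)\in\mathcal D\times\mathbb R,$$ with $\Pi(0)=(x_0,y_0,y_0)$. Then the problem $$\mathcal P_3:\quad \inf_{\Pi(\cdot)\in\mathcal S_\ell} z(T)$$ admits an optimal solution. Moreover, any optimal solution $\Pi(\cdot)=(x(\cdot),y(\cdot),z(\cdot))$ of $\mathcal P_3$ satisfies $$z(T)=\max_{t\in[0,T]}y(t),$$ where $(x(\cdot),y(\cdot))$ is the solution of $\dot x=f(x,y,u)$, $\dot y=g(x,y,u)$, $(x(0),y(0))=(x_0,y_0)$, for some control $u(\cdot)\in\mathcal U$ that is optimal for the problem $$\mathcal P:\quad \inf_{u(\cdot)\in\mathcal U}\Big(\max_{t\in[0,T]}y(t)\Big).$$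
   Context: Setting. Let $\mathcal D\subset\mathbb R^{n+1}$ be a domain and $U\subset\mathbb R^p$ (non-empty). Let $f:\mathcal D\times U\to\mathbb R^n$ and $g:\mathcal D\times U\to\mathbb R$ define the controlled system $$\dot x=f(x,y,u),\qquad \dot y=g(x,y,u),\qquad (x,y)\in\mathcal D,\ u\in U,$$ and assume that $\mathcal D$ is invariant for this system (solutions starting in $\mathcal D$ stay in $\mathcal D$, whatever the control). Assumption (A1): (i) $U$ is compact; (ii) $f$ and $g$ are $C^1$ on $\mathcal D\times U$; (iii) $f,g$ have linear growth: there is $C>0$ with $\|f(x,y,u)\|+|g(x,y,u)|\le C(1+\|x\|+|y|)$ for all $(x,y)\in\mathcal D$, $u\in U$. Assumption (A2): for every $(x,y)\in\mathcal D$ the set $G(x,y):=\bigcup_{u\in U}\{(f(x,y,u),g(x,y,u))\}\subset\mathbb R^{n+1}$ is convex. Notation. $\mathcal U$ is the set of measurable functions $u(\cdot):[0,T]\to U$. $\mathbb 1_{\mathbb R^+}(\zeta)=1$ if $\zeta\ge 0$ and $0$ if $\zeta<0$. Solutions of the control system are absolutely continuous functions satisfying the equations for a.e. $t$; under (A1) they exist on $[0,T]$ and are unique for each control and initial condition. In $\mathcal P$, $(x(\cdot),y(\cdot))$ denotes the solution associated with $u(\cdot)$ with $(x(0),y(0))=(x_0,y_0)$. A solution of the differential inclusion is an absolutely continuous $\Pi(\cdot)$ with values in $\mathcal D\times\mathbb R$ and $\dot\Pi(t)\in F(\Pi(t))$ for a.e. $t\in[0,T]$. An optimal solution/control is one attaining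 the infimum. *)

theory Defs
  imports "HOL-Analysis.Analysis"
begin

text \<open>A state is a pair \<open>(x, y)\<close> and an extended state a triple \<open>(x, y, z)\<close>. The fields \<open>f\<close>, \<open>g\<close> are
  total functions, but their values outside \<open>D \<times> U\<close> are never used.\<close>

type_synonym 'n state = "(real^'n) \<times> real"
type_synonym 'n xstate = "(real^'n) \<times> real \<times> real"

text \<open>The set \<open>S\<close> need not be open (here it is \<open>D \<times> U\<close> with \<open>U\<close> compact), so derivatives are taken
  within \<open>S\<close>. This is implied by the existence of a \<open>C\<^sup>1\<close> extension to a neighbourhood of \<open>S\<close>.\<close>

definition C1_on :: "'a::real_normed_vector set \<Rightarrow> ('a \<Rightarrow> 'b::real_normed_vector) \<Rightarrow> bool" where
  "C1_on S h \<longleftrightarrow> (\<exists>h' :: 'a \<Rightarrow> 'a \<Rightarrow>\<^sub>L 'b.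
     (\<forall>p\<in>S. (h has_derivative blinfun_apply (h' p)) (at p within S)) \<and> continuous_on S h')"

definition abs_continuous_on :: "real \<Rightarrow> real \<Rightarrow> (real \<Rightarrow> 'a::metric_space) \<Rightarrow> bool" where
  "abs_continuous_on a b w \<longleftrightarrow>
     (\<forall>\<epsilon>>0. \<exists>\<delta>>0. \<forall>I :: (real \<times> real) set.
        finite I \<longrightarrow> (\<forall>(s, t)\<in>I. a \<le> s \<and> s \<le> t \<and> t \<le> b) \<longrightarrow>
        disjoint_family_on (\<lambda>(s, t). {s<..<t}) I \<longrightarrow>
        (\<Sum>(s, t)\<in>I. t - s) < \<delta> \<longrightarrow> (\<Sum>(s, t)\<in>I. dist (w s) (w t)) < \<epsilon>)"

definition controls :: "(real^'p) set \<Rightarrow> real \<Rightarrow> (real \<Rightarrow> real^'p) set" where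
  "controls U T = {u \<in> borel_measurable (lebesgue_on {0..T}). \<forall>t\<in>{0..T}. u t \<in> U}"

definition satisfies_control_ode ::
  "('n::finite state \<times> (real^'p) \<Rightarrow> real^'n) \<Rightarrow> ('n state \<times> (real^'p) \<Rightarrow> real) \<Rightarrow> real \<Rightarrow>
   (real \<Rightarrow> real^'p) \<Rightarrow> (real \<Rightarrow> 'n state) \<Rightarrow> bool" where
  "satisfies_control_ode f g T u w \<longleftrightarrow> abs_continuous_on 0 T w \<and>
     (AE t in lebesgue_on {0..T}.
        (w has_vector_derivative (f (w t, u t), g (w t, u t))) (at t within {0..T}))"

text \<open>No trajectory starting in \<open>D\<close> can leave \<open>D\<close>. As \<open>f\<close> and \<open>g\<close> are only given on \<open>D \<times> U\<close>, this says
  that a trajectory which is in \<open>D\<close> before time \<open>\<tau>\<close> is still in \<open>D\<close> at time \<open>\<tau>\<close>.\<close>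

definition invariant_domain ::
  "'n::finite state set \<Rightarrow> (real^'p) set \<Rightarrow> ('n state \<times> (real^'p) \<Rightarrow> real^'n) \<Rightarrow>
   ('n state \<times> (real^'p) \<Rightarrow> real) \<Rightarrow> bool" where
  "invariant_domain D U f g \<longleftrightarrow>
     (\<forall>\<tau>>0. \<forall>u\<in>controls U \<tau>. \<forall>w. satisfies_control_ode f g \<tau> u w \<longrightarrow>
        (\<forall>t\<in>{0..<\<tau>}. w t \<in> D) \<longrightarrow> w \<tau> \<in> D)"

text \<open>Admissible pairs of a control and its trajectory. Under the standing assumptions every control
  has exactly one trajectory on \<open>{0..T}\<close>, so minimising over these pairs is minimising over controls.\<close>

definition admissible_pairs ::
  "'n::finite state set \<Rightarrow> (real^'p) set \<Rightarrow> ('n state \<times> (real^'p) \<Rightarrow> real^'n) \<Rightarrow>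
   ('n state \<times> (real^'p) \<Rightarrow> real) \<Rightarrow> real \<Rightarrow> 'n state \<Rightarrow>
   ((real \<Rightarrow> real^'p) \<times> (real \<Rightarrow> 'n state)) set" where
  "admissible_pairs D U f g T w0 = {(u, w). u \<in> controls U T \<and>
     satisfies_control_ode f g T u w \<and> (\<forall>t\<in>{0..T}. w t \<in> D) \<and> w 0 = w0}"

text \<open>The supremum is a maximum for the continuous functions to which this is applied.\<close>

definition max_over :: "real \<Rightarrow> (real \<Rightarrow> real) \<Rightarrow> real" where
  "max_over T y = (SUP t\<in>{0..T}. y t)"

definition optimal_P ::
  "'n::finite state set \<Rightarrow> (real^'p) set \<Rightarrow> ('n state \<times> (real^'p) \<Rightarrow> real^'n) \<Rightarrow>
   ('n state \<times> (real^'p) \<Rightarrow> real) \<Rightarrow> real \<Rightarrow> 'n state \<Rightarrow>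
   (real \<Rightarrow> real^'p) \<Rightarrow> (real \<Rightarrow> 'n state) \<Rightarrow> bool" where
  "optimal_P D U f g T w0 u w \<longleftrightarrow>
     is_arg_min (\<lambda>(u, w). max_over T (\<lambda>t. snd (w t)))
       (\<lambda>uw. uw \<in> admissible_pairs D U f g T w0) (u, w)"

definition F_incl ::
  "(real^'p) set \<Rightarrow> ('n::finite state \<times> (real^'p) \<Rightarrow> real^'n) \<Rightarrow>
   ('n state \<times> (real^'p) \<Rightarrow> real) \<Rightarrow> 'n xstate \<Rightarrow> 'n xstate set" where
  "F_incl U f g = (\<lambda>(x, y, z). \<Union>(u, v) \<in> U \<times> {0..1}.
     {(f ((x, y), u), g ((x, y), u),
       max (g ((x, y), u)) 0 * (1 - v * indicator {0..} (z - y)))})"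

definition S_l ::
  "'n::finite state set \<Rightarrow> (real^'p) set \<Rightarrow> ('n state \<times> (real^'p) \<Rightarrow> real^'n) \<Rightarrow>
   ('n state \<times> (real^'p) \<Rightarrow> real) \<Rightarrow> real \<Rightarrow> real^'n \<Rightarrow> real \<Rightarrow> (real \<Rightarrow> 'n xstate) set" where
  "S_l D U f g T x0 y0 = {\<xi>. abs_continuous_on 0 T \<xi> \<and>
     (\<forall>t\<in>{0..T}. \<xi> t \<in> {(x, y, z). (x, y) \<in> D}) \<and>
     (AE t in lebesgue_on {0..T}. \<exists>d \<in> F_incl U f g (\<xi> t).
        (\<xi> has_vector_derivative d) (at t within {0..T})) \<and>
     \<xi> 0 = (x0, y0, y0)}"

definition optimal_P3 ::
  "'n::finite state set \<Rightarrow> (real^'p) set \<Rightarrow> ('n state \<times> (real^'p) \<Rightarrow> real^'n) \<Rightarrow>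
   ('n state \<times> (real^'p) \<Rightarrow> real) \<Rightarrow> real \<Rightarrow> real^'n \<Rightarrow> real \<Rightarrow> (real \<Rightarrow> 'n xstate) \<Rightarrow> bool" where
  "optimal_P3 D U f g T x0 y0 \<xi> \<longleftrightarrow>
     is_arg_min (\<lambda>\<xi>. snd (snd (\<xi> T))) (\<lambda>\<xi>. \<xi> \<in> S_l D U f g T x0 y0) \<xi>"

end

theory Submission
  imports Defs "HOL-Complex_Analysis.Great_Picard"
begin

text \<open>Along a solution of the inclusion \<open>z \<ge> y\<close> always holds and \<open>z\<close> is nondecreasing, so
  \<open>z T \<ge> max y\<close>; by Filippov's selection lemma \<open>(x, y)\<close> is a trajectory of the control system.
  Conversely a trajectory together with its running maximum \<open>z t = max_over t y\<close> solves the inclusion.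
  Hence both problems have the same value, and it remains to find a minimiser of \<open>max y\<close> over
  trajectories. A minimising sequence is equi-Lipschitz, so it has a uniform limit. Its derivative lies
  in the convex compact velocity sets, since difference quotients of the approximating curves do so
  up to an arbitrarily small error. The limit cannot leave \<open>D\<close>, because at a first exit time it would be
  a trajectory contradicting invariance. The same argument applied to Euler polygons yields the existence of trajectories.\<close>

section \<open>Absolutely continuous curves\<close>

text \<open>Compactness is used for the control system and not for the inclusion, because the values
  of the latter need not be convex: where \<open>z >= y\<close> the third velocity fills the range
  from 0 to \<open>max g 0\<close>, a convex function of \<open>g\<close>, so the set fails to be
  convex as soon as \<open>g\<close> takes both signs at a state. The minimiser is therefore built
  from \<open>(x, y)\<close> alone, where (A2) applies, and then lifted. The uniform limit and the
  running maximum are both Lipschitz curves whose derivatives are not given in advance; hence the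
  almost everywhere differentiability of Lipschitz functions. Velocities of a limit are tested
  against half spaces: a vector outside a closed convex set is cut off by a hyperplane, and a linear
  bound on velocities passes to difference quotients and to their limits. Euler polygons may leave
  \<open>D\<close>, so membership in the velocity set is asked only at points of \<open>D\<close>
  until invariance is available. Their velocity is the field at a slightly earlier time, which is
  why the estimates carry a delay.\<close>

lemma AE_lebesgue_on_negligible_iff:
  fixes S :: "'a::euclidean_space set"
  assumes "S \<in> sets lebesgue"
  shows "(AE t in lebesgue_on S. P t) \<longleftrightarrow> (\<exists>N. negligible N \<and> (\<forall>t\<in>S - N. P t))"
proof -
  have "(AE t in lebesgue_on S. P t) \<longleftrightarrow> (AE t in lebesgue. t \<in> S \<longrightarrow> P t)"
    by (rule AE_restrict_space_iff) (use assms in simp)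
  also have "\<dots> \<longleftrightarrow> (\<exists>N. negligible N \<and> (\<forall>t\<in>S - N. P t))"
    by (auto simp: eventually_ae_filter negligible_iff_null_sets)
  finally show ?thesis .
qed

lemma sets_lebesgue_Icc [simp]: "{a..b::real} \<in> sets lebesgue"
  by (simp flip: box_real)

lemma negligible_open_cover:
  fixes N :: "'a::euclidean_space set"
  assumes "negligible N" "e > 0"
  obtains O' where "open O'" "N \<subseteq> O'" "O' \<in> lmeasurable" "measure lebesgue O' < e"
proof -
  have N: "N \<in> sets lebesgue" "N \<in> lmeasurable" "measure lebesgue N = 0"
    using assms(1) by (auto simp: negligible_iff_measure negligible_imp_sets)
  obtain O' where O': "open O'" "N \<subseteq> O'" "O' - N \<in> lmeasurable" "emeasure lebesgue (O' - N) < ennreal e"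
    using sets_lebesgue_outer_open[OF N(1) assms(2)] by blast
  have eq: "O' = N \<union> (O' - N)" using O' by blast
  have O'm: "O' \<in> lmeasurable" using eq N(2) O'(3) by (metis fmeasurable.Un)
  have "measure lebesgue (O' - N) < e"
    using O'(3,4) assms(2) by (simp add: emeasure_eq_measure2 ennreal_less_iff)
  moreover have "measure lebesgue O' \<le> measure lebesgue N + measure lebesgue (O' - N)"
    by (subst eq) (rule measure_Un_le; use N O' in \<open>simp add: fmeasurableD\<close>)
  ultimately show ?thesis using that[OF O'(1,2) O'm] N by simp
qed

lemma abs_continuous_onE:
  assumes "abs_continuous_on a b w" "e > 0"
  obtains \<delta> where "\<delta> > 0" "\<And>I :: (real \<times> real) set. finite I \<Longrightarrow>
        (\<forall>(s, t)\<in>I. a \<le> s \<and> s \<le> t \<and> t \<le> b) \<Longrightarrow> disjoint_family_on (\<lambda>(s, t). {s<..<t}) I \<Longrightarrow>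
        (\<Sum>(s, t)\<in>I. t - s) < \<delta> \<Longrightarrow> (\<Sum>(s, t)\<in>I. dist (w s) (w t)) < e"
  using assms unfolding abs_continuous_on_def by meson

text \<open>Cousin's lemma: pieces tagged outside the exceptional set obey the derivative bound, and pieces
  tagged inside it have small total length, hence small total increment.\<close>

lemma abs_continuous_increment_le:
  fixes \<phi> :: "real \<Rightarrow> real"
  assumes ab: "a \<le> b" and ac: "abs_continuous_on a b \<phi>" and N: "negligible N"
    and der: "\<And>t. t \<in> {a..b} - N \<Longrightarrow> \<exists>d\<le>c. (\<phi> has_vector_derivative d) (at t within {a..b})"
  shows "\<phi> b - \<phi> a \<le> c * (b - a)"
proof -
  have main: "\<phi> b - \<phi> a \<le> (c + e) * (b - a) + 2 * e" if e: "e > 0" for e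
  proof -
    obtain \<delta> where \<delta>: "\<delta> > 0" "\<And>I :: (real \<times> real) set. finite I \<Longrightarrow>
        (\<forall>(s, t)\<in>I. a \<le> s \<and> s \<le> t \<and> t \<le> b) \<Longrightarrow> disjoint_family_on (\<lambda>(s, t). {s<..<t}) I \<Longrightarrow>
        (\<Sum>(s, t)\<in>I. t - s) < \<delta> \<Longrightarrow> (\<Sum>(s, t)\<in>I. dist (\<phi> s) (\<phi> t)) < e"
      using abs_continuous_onE[OF ac e] by blast
    \<comment> \<open>\<open>\<delta>\<close> makes the increments of \<open>\<phi>\<close> over the
      bad pieces sum to less than \<open>e\<close>; the second bound does the same for the linear
      term with slope \<open>c + e\<close>.\<close>
    define \<delta>' where "\<delta>' = min \<delta> (e / (\<bar>c\<bar> + e + 1))"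
    have "\<delta>' > 0" using \<delta> e by (simp add: \<delta>'_def add_nonneg_pos)
    then obtain O' where O': "open O'" "N \<subseteq> O'" "O' \<in> lmeasurable" "measure lebesgue O' < \<delta>'"
      using negligible_open_cover[OF N] by blast
    \<comment> \<open>The bound is stated on each side of the tag, so that a piece with
      \<open>t\<close> inside is handled by adding its two halves.\<close>
    have "\<exists>\<eta>>0. \<forall>s\<in>{a..b}. \<bar>s - t\<bar> < \<eta> \<longrightarrow>
        (s \<ge> t \<longrightarrow> \<phi> s - \<phi> t \<le> (c + e) * (s - t)) \<and> (s \<le> t \<longrightarrow> \<phi> t - \<phi> s \<le> (c + e) * (t - s))"
      if t: "t \<in> {a..b} - N" for t
    proof -
      obtain d where d: "d \<le> c" "(\<phi> has_vector_derivative d) (at t within {a..b})"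
        using der[OF t] by blast
      then obtain \<eta> where \<eta>: "\<eta> > 0"
        "\<And>s. s \<in> {a..b} \<Longrightarrow> \<bar>s - t\<bar> < \<eta> \<Longrightarrow> \<bar>\<phi> s - \<phi> t - (s - t) * d\<bar> \<le> e * \<bar>s - t\<bar>"
        unfolding has_vector_derivative_def has_derivative_within_alt real_norm_def real_scaleR_def
        using e by meson
      have "\<phi> s - \<phi> t \<le> (c + e) * (s - t)" if "s \<in> {a..b}" "\<bar>s - t\<bar> < \<eta>" "s \<ge> t" for s
      proof -
        have "(s - t) * d \<le> (s - t) * c" using d that by (intro mult_left_mono) auto
        then show ?thesis using \<eta>(2)[OF that(1,2)] that by (auto simp: algebra_simps)
      qed
      moreover have "\<phi> t - \<phi> s \<le> (c + e) * (t - s)" if "s \<in> {a..b}" "\<bar>s - t\<bar> < \<eta>" "s \<le> t" for s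
      proof -
        have "(t - s) * d \<le> (t - s) * c" using d that by (intro mult_left_mono) auto
        then show ?thesis using \<eta>(2)[OF that(1,2)] that by (auto simp: algebra_simps)
      qed
      ultimately show ?thesis using \<eta>(1) by blast
    qed
    then obtain \<eta> where \<eta>: "\<And>t. t \<in> {a..b} - N \<Longrightarrow> \<eta> t > 0"
      "\<And>t s. t \<in> {a..b} - N \<Longrightarrow> s \<in> {a..b} \<Longrightarrow> \<bar>s - t\<bar> < \<eta> t \<Longrightarrow> s \<ge> t \<Longrightarrow> \<phi> s - \<phi> t \<le> (c + e) * (s - t)"
      "\<And>t s. t \<in> {a..b} - N \<Longrightarrow> s \<in> {a..b} \<Longrightarrow> \<bar>s - t\<bar> < \<eta> t \<Longrightarrow> s \<le> t \<Longrightarrow> \<phi> t - \<phi> s \<le> (c + e) * (t - s)"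
      by metis
    define \<gamma> where "\<gamma> t = (if t \<in> N then O' else if t \<in> {a..b} then ball t (\<eta> t) else UNIV)" for t
    have "gauge \<gamma>" using O' \<eta>(1) by (auto simp: gauge_def \<gamma>_def)
    then obtain p where p: "p tagged_division_of {a..b}" "\<gamma> fine p"
      using fine_division_exists_real by blast
    define q where "q = {(x, K) \<in> p. x \<in> N}"
    \<comment> \<open>The excess of an increment over slope \<open>c + e\<close>: nonpositive on
      good pieces and telescoping over the whole division.\<close>
    define \<Delta> where "\<Delta> = (\<lambda>(x::real, K). \<phi> (Sup K) - \<phi> (Inf K) - (c + e) * (Sup K - Inf K))"
    have fin: "finite p" "finite q" "q \<subseteq> p" using p by (auto simp: q_def intro: finite_subset)
    have piece: "\<exists>u v. K = {u..v} \<and> u \<le> x \<and> x \<le> v \<and> a \<le> u \<and> v \<le> b" if "(x, K) \<in> p" for x K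
    proof -
      have "x \<in> K" "K \<subseteq> {a..b}" "\<exists>u v. K = cbox u v" using p(1) that by blast+
      then show ?thesis by (auto simp: box_real)
    qed
    have good: "\<Delta> xK \<le> 0" if "xK \<in> p - q" for xK
    proof -
      obtain x K where xK: "xK = (x, K)" by force
      have "(x, K) \<in> p" using that xK by auto
      then obtain u v where uv: "K = {u..v}" "u \<le> x" "x \<le> v" "a \<le> u" "v \<le> b"
        using piece by blast
      have x: "x \<in> {a..b} - N" using that uv xK by (auto simp: q_def)
      have "K \<subseteq> \<gamma> x" using p(2) that xK by (auto simp: fine_def)
      then have "K \<subseteq> ball x (\<eta> x)" using x by (auto simp: \<gamma>_def)
      moreover have "u \<in> K" "v \<in> K" using uv by auto
      ultimately have "u \<in> ball x (\<eta> x)" "v \<in> ball x (\<eta> x)" by blast+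
      then have "\<bar>u - x\<bar> < \<eta> x" "\<bar>v - x\<bar> < \<eta> x" by (auto simp: dist_real_def abs_minus_commute)
      then have "\<phi> v - \<phi> x \<le> (c + e) * (v - x)" "\<phi> x - \<phi> u \<le> (c + e) * (x - u)"
        using \<eta>(2,3)[OF x] uv by auto
      then show ?thesis using uv by (simp add: \<Delta>_def xK algebra_simps)
    qed
    define I where "I = (\<lambda>(x, K). (Inf K, Sup K)) ` q"
    have qpd: "q tagged_partial_division_of {a..b}"
      using p(1) fin(3) by (meson tagged_division_of_def tagged_partial_division_subset)
    have pieceq: "\<exists>u v. K = {u..v} \<and> u \<le> x \<and> x \<le> v \<and> u \<le> v" if "(x, K) \<in> q" for x K
      using piece[of x K] that fin(3) by (metis order_trans subsetD)
    have dis: "{Inf K<..<Sup K} \<inter> {Inf L<..<Sup L} = {}"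
      if *: "(x, K) \<in> q" "(y, L) \<in> q" "(x, K) \<noteq> (y, L)" for x K y L
    proof -
      have "interior K \<inter> interior L = {}" using qpd * unfolding tagged_partial_division_of_def by blast
      moreover obtain u v where "K = {u..v}" "u \<le> v" using pieceq *(1) by blast
      moreover obtain u' v' where "L = {u'..v'}" "u' \<le> v'" using pieceq *(2) by blast
      ultimately show ?thesis by (simp add: interior_atLeastAtMost_real)
    qed
    \<comment> \<open>Absolute continuity speaks of a set of intervals, so distinct tagged pieces
      must not collapse to one pair. Nondegenerate pieces are separated by their interiors; a
      degenerate piece determines its tag.\<close>
    have inj: "inj_on (\<lambda>(x::real, K). (Inf K, Sup K)) q"
    proof (rule inj_onI, clarify)
      fix x K y L assume *: "(x, K) \<in> q" "(y, L) \<in> q" "Inf K = Inf L" "Sup K = Sup L"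
      obtain u v where 1: "K = {u..v}" "u \<le> x" "x \<le> v" using pieceq *(1) by blast
      obtain u' v' where 2: "L = {u'..v'}" "u' \<le> y" "y \<le> v'" using pieceq *(2) by blast
      have eq: "u = u'" "v = v'" using * 1 2 by auto
      show "x = y \<and> K = L"
      proof (cases "u = v")
        case True then show ?thesis using 1 2 eq by auto
      next
        case False
        then have "{Inf K<..<Sup K} \<inter> {Inf L<..<Sup L} \<noteq> {}" using 1 2 eq dense[of u v] by auto
        then have "(x, K) = (y, L)" using dis[OF *(1,2)] by blast
        then show ?thesis by simp
      qed
    qed
    have len: "(\<Sum>(x, K)\<in>q. Sup K - Inf K) < \<delta>'"
    proof -
      have "(\<Sum>(x, K)\<in>q. Sup K - Inf K) = (\<Sum>(x, K)\<in>q. measure lebesgue K)"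
      proof (rule sum.cong[OF refl], clarify)
        fix x K assume "(x, K) \<in> q"
        then obtain u v where "K = {u..v}" "u \<le> v" using pieceq by blast
        then show "Sup K - Inf K = measure lebesgue K" by (simp add: measure_completion)
      qed
      also have "\<dots> = (\<Sum>K\<in>snd ` q. measure lebesgue K)"
      proof -
        have "inj_on snd q"
          by (rule inj_onI, rule inj_onD[OF inj]) (auto simp: case_prod_unfold)
        then show ?thesis by (simp add: sum.reindex case_prod_unfold)
      qed
      also have "\<dots> = measure lebesgue (\<Union>(snd ` q))"
        using content_division[OF partial_division_of_tagged_division[OF qpd]] .
      also have "\<dots> \<le> measure lebesgue O'"
      proof (rule measure_mono_fmeasurable)
        show "\<Union>(snd ` q) \<subseteq> O'"
        proof clarsimp
          fix x K t assume "(x, K) \<in> q" "t \<in> K"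
          then have "x \<in> N" "K \<subseteq> \<gamma> x" using p(2) by (auto simp: q_def fine_def)
          then show "t \<in> O'" using \<open>t \<in> K\<close> by (auto simp: \<gamma>_def)
        qed
        show "\<Union>(snd ` q) \<in> sets lebesgue"

        proof (rule sets.finite_Union)
          show "snd ` q \<subseteq> sets lebesgue"
          proof clarsimp
            fix x K assume "(x, K) \<in> q"
            then obtain u v where "K = {u..v}" using pieceq[of x K] by blast
            then show "K \<in> sets lebesgue" by simp
          qed
        qed (use fin in simp)
      qed (use O' in auto)
      finally show ?thesis using O' by linarith
    qed
    have "(\<Sum>(s, t)\<in>I. dist (\<phi> s) (\<phi> t)) < e"
    proof (rule \<delta>(2))
      show "finite I" using fin by (simp add: I_def)
      show "\<forall>(s, t)\<in>I. a \<le> s \<and> s \<le> t \<and> t \<le> b"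
      proof -
        have "a \<le> Inf K \<and> Inf K \<le> Sup K \<and> Sup K \<le> b" if "(x, K) \<in> q" for x K
        proof -
          have "(x, K) \<in> p" using that fin(3) by blast
          then obtain u v where "K = {u..v}" "u \<le> x" "x \<le> v" "a \<le> u" "v \<le> b" using piece by blast
          then show ?thesis by simp
        qed
        then show ?thesis by (auto simp: I_def)
      qed
      show "disjoint_family_on (\<lambda>(s, t). {s<..<t}) I"
        unfolding disjoint_family_on_def
      proof (intro ballI impI)
        fix i j assume *: "i \<in> I" "j \<in> I" "i \<noteq> j"
        then obtain x K y L where "(x, K) \<in> q" "(y, L) \<in> q" "i = (Inf K, Sup K)" "j = (Inf L, Sup L)"
          by (auto simp: I_def)
        then show "(case i of (s, t) \<Rightarrow> {s<..<t}) \<inter> (case j of (s, t) \<Rightarrow> {s<..<t}) = {}"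
          using dis[of x K y L] * by auto
      qed
      have "(\<Sum>(s, t)\<in>I. t - s) = (\<Sum>(x, K)\<in>q. Sup K - Inf K)"
        unfolding I_def by (subst sum.reindex[OF inj]) (simp add: case_prod_unfold o_def)
      then show "(\<Sum>(s, t)\<in>I. t - s) < \<delta>" using len by (simp add: \<delta>'_def)
    qed
    also have "(\<Sum>(s, t)\<in>I. dist (\<phi> s) (\<phi> t)) = (\<Sum>(x, K)\<in>q. \<bar>\<phi> (Sup K) - \<phi> (Inf K)\<bar>)"
      unfolding I_def by (subst sum.reindex[OF inj]) (simp add: case_prod_unfold o_def dist_real_def abs_minus_commute)
    finally have bad1: "(\<Sum>(x, K)\<in>q. \<bar>\<phi> (Sup K) - \<phi> (Inf K)\<bar>) < e" .
    have "sum \<Delta> q \<le> (\<Sum>(x, K)\<in>q. \<bar>\<phi> (Sup K) - \<phi> (Inf K)\<bar> + (\<bar>c\<bar> + e + 1) * (Sup K - Inf K))"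
    proof (rule sum_mono, simp only: split_paired_all prod.case)
      fix x K assume "(x, K) \<in> q"
      then obtain u v where uv: "K = {u..v}" "u \<le> v" using pieceq[of x K] by blast
      \<comment> \<open>\<open>c\<close> may be negative, in which case subtracting the linear term
        adds to the excess; the factor with \<open>\<bar>c\<bar>\<close> covers both signs.\<close>
      have "- (c + e) * (v - u) \<le> (\<bar>c\<bar> + e + 1) * (v - u)"
        using uv e by (intro mult_right_mono) auto
      then have "- ((c + e) * (v - u)) \<le> (\<bar>c\<bar> + e + 1) * (v - u)" by (simp only: mult_minus_left)
      moreover have "\<phi> v - \<phi> u \<le> \<bar>\<phi> v - \<phi> u\<bar>" by simp
      ultimately show "\<Delta> (x, K) \<le> \<bar>\<phi> (Sup K) - \<phi> (Inf K)\<bar> + (\<bar>c\<bar> + e + 1) * (Sup K - Inf K)"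
        using uv unfolding \<Delta>_def prod.case by simp
    qed
    also have "\<dots> = (\<Sum>(x, K)\<in>q. \<bar>\<phi> (Sup K) - \<phi> (Inf K)\<bar>) + (\<bar>c\<bar> + e + 1) * (\<Sum>(x, K)\<in>q. Sup K - Inf K)"
      by (simp add: case_prod_unfold sum.distrib sum_distrib_left)
    also have "\<dots> \<le> e + (\<bar>c\<bar> + e + 1) * \<delta>'"
      using bad1 len e by (intro add_mono mult_left_mono) auto
    also have "\<dots> \<le> e + (\<bar>c\<bar> + e + 1) * (e / (\<bar>c\<bar> + e + 1))"
      using e by (intro add_mono mult_left_mono) (auto simp: \<delta>'_def)
    also have "\<dots> = 2 * e" using e by (simp add: field_simps)
    finally have bad: "sum \<Delta> q \<le> 2 * e" .
    have "sum \<Delta> p = sum \<Delta> (p - q) + sum \<Delta> q" using fin by (simp add: sum.subset_diff)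
    also have "\<dots> \<le> 2 * e" using bad sum_nonpos[of "p - q" \<Delta>, OF good] by linarith
    finally have "sum \<Delta> p \<le> 2 * e" .
    moreover have "sum \<Delta> p = (\<phi> b - (c + e) * b) - (\<phi> a - (c + e) * a)"
      using additive_tagged_division_1[OF ab p(1), of "\<lambda>t. \<phi> t - (c + e) * t"]
      by (simp add: \<Delta>_def case_prod_unfold algebra_simps)
    ultimately show ?thesis by (simp add: algebra_simps)
  qed
  show ?thesis
  proof (rule field_le_epsilon)
    fix k :: real assume "k > 0"
    \<comment> \<open>The total error is \<open>e * (b - a) + 2 * e\<close>, so \<open>e\<close> is
      chosen to make it \<open>k\<close>.\<close>
    then have "k / (b - a + 2) > 0" using ab by simp
    then have "\<phi> b - \<phi> a \<le> (c + k / (b - a + 2)) * (b - a) + 2 * (k / (b - a + 2))" by (rule main)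
    also have "\<dots> = c * (b - a) + k / (b - a + 2) * (b - a + 2)" by (simp only: algebra_simps)
    also have "\<dots> = c * (b - a) + k" using ab by simp
    finally show "\<phi> b - \<phi> a \<le> c * (b - a) + k" .
  qed
qed

text \<open>Transfers absolute continuity from a curve to its components, their differences and
  linear functionals of it.\<close>

lemma abs_continuous_on_compare:
  assumes "abs_continuous_on a b w"
    and "\<And>s t. a \<le> s \<Longrightarrow> s \<le> t \<Longrightarrow> t \<le> b \<Longrightarrow> dist (v s) (v t) \<le> K * dist (w s) (w t)"
  shows "abs_continuous_on a b v"
  unfolding abs_continuous_on_def
proof (intro allI impI)
  fix e :: real assume e: "e > 0"
  define K' where "K' = \<bar>K\<bar> + 1"
  have K': "K' > 0" "K \<le> K'" by (auto simp: K'_def)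
  obtain \<delta> where \<delta>: "\<delta> > 0" "\<And>I :: (real \<times> real) set. finite I \<Longrightarrow>
        (\<forall>(s, t)\<in>I. a \<le> s \<and> s \<le> t \<and> t \<le> b) \<Longrightarrow> disjoint_family_on (\<lambda>(s, t). {s<..<t}) I \<Longrightarrow>
        (\<Sum>(s, t)\<in>I. t - s) < \<delta> \<Longrightarrow> (\<Sum>(s, t)\<in>I. dist (w s) (w t)) < e / K'"
    using abs_continuous_onE[OF assms(1), of "e / K'"] e K' by auto
  show "\<exists>\<delta>>0. \<forall>I :: (real \<times> real) set.
        finite I \<longrightarrow> (\<forall>(s, t)\<in>I. a \<le> s \<and> s \<le> t \<and> t \<le> b) \<longrightarrow>
        disjoint_family_on (\<lambda>(s, t). {s<..<t}) I \<longrightarrow>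
        (\<Sum>(s, t)\<in>I. t - s) < \<delta> \<longrightarrow> (\<Sum>(s, t)\<in>I. dist (v s) (v t)) < e"
  proof (intro exI[of _ \<delta>] conjI \<delta>(1) allI impI)
    fix I :: "(real \<times> real) set"
    assume I: "finite I" "\<forall>(s, t)\<in>I. a \<le> s \<and> s \<le> t \<and> t \<le> b"
      "disjoint_family_on (\<lambda>(s, t). {s<..<t}) I" "(\<Sum>(s, t)\<in>I. t - s) < \<delta>"
    have "dist (v s) (v t) \<le> K' * dist (w s) (w t)" if "(s, t) \<in> I" for s t
    proof -
      have "dist (v s) (v t) \<le> K * dist (w s) (w t)" using assms(2)[of s t] I(2) that by blast
      also have "\<dots> \<le> K' * dist (w s) (w t)" using K' by (intro mult_right_mono) auto
      finally show ?thesis .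
    qed
    then have "(\<Sum>(s, t)\<in>I. dist (v s) (v t)) \<le> (\<Sum>(s, t)\<in>I. K' * dist (w s) (w t))"
      by (intro sum_mono) auto
    also have "\<dots> = K' * (\<Sum>(s, t)\<in>I. dist (w s) (w t))"
      by (simp add: sum_distrib_left case_prod_unfold)
    also have "\<dots> < K' * (e / K')" using \<delta>(2)[OF I] K' by (intro mult_strict_left_mono)
    also have "\<dots> = e" using K' by simp
    finally show "(\<Sum>(s, t)\<in>I. dist (v s) (v t)) < e" .
  qed
qed

lemma lipschitz_imp_abs_continuous_on:
  assumes "L-lipschitz_on {a..b::real} w"
  shows "abs_continuous_on a b w"
proof (rule abs_continuous_on_compare[where K = L and w = "\<lambda>t. t"])
  show "abs_continuous_on a b (\<lambda>t. t)"
    unfolding abs_continuous_on_def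
  proof (intro allI impI)
    fix e :: real assume "e > 0"
    moreover have "(\<Sum>(s, t)\<in>I. dist s t) = (\<Sum>(s, t)\<in>I. t - s)"
      if "\<forall>(s, t)\<in>I. a \<le> s \<and> s \<le> t \<and> t \<le> b" for I :: "(real \<times> real) set"
      using that by (intro sum.cong) (auto simp: dist_real_def)
    ultimately show "\<exists>\<delta>>0. \<forall>I :: (real \<times> real) set.
        finite I \<longrightarrow> (\<forall>(s, t)\<in>I. a \<le> s \<and> s \<le> t \<and> t \<le> b) \<longrightarrow>
        disjoint_family_on (\<lambda>(s, t). {s<..<t}) I \<longrightarrow>
        (\<Sum>(s, t)\<in>I. t - s) < \<delta> \<longrightarrow> (\<Sum>(s, t)\<in>I. dist s t) < e"
      by (intro exI[of _ e]) simp
  qed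
  show "dist (w s) (w t) \<le> L * dist s t" if "a \<le> s" "s \<le> t" "t \<le> b" for s t
    using lipschitz_onD[OF assms] that by simp
qed

lemma abs_continuous_on_subinterval:
  assumes "abs_continuous_on a b w" "a \<le> c" "d \<le> b"
  shows "abs_continuous_on c d w"
  unfolding abs_continuous_on_def
proof (intro allI impI)
  fix e :: real assume "e > 0"
  then obtain \<delta> where \<delta>: "\<delta> > 0" "\<And>I :: (real \<times> real) set. finite I \<Longrightarrow>
        (\<forall>(s, t)\<in>I. a \<le> s \<and> s \<le> t \<and> t \<le> b) \<Longrightarrow> disjoint_family_on (\<lambda>(s, t). {s<..<t}) I \<Longrightarrow>
        (\<Sum>(s, t)\<in>I. t - s) < \<delta> \<Longrightarrow> (\<Sum>(s, t)\<in>I. dist (w s) (w t)) < e"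
    using abs_continuous_onE[OF assms(1)] by blast
  have "(\<Sum>(s, t)\<in>I. dist (w s) (w t)) < e"
    if "finite I" "\<forall>(s, t)\<in>I. c \<le> s \<and> s \<le> t \<and> t \<le> d"
      "disjoint_family_on (\<lambda>(s, t). {s<..<t}) I" "(\<Sum>(s, t)\<in>I. t - s) < \<delta>" for I :: "(real \<times> real) set"
    by (rule \<delta>(2)) (use that assms(2,3) in \<open>auto split: prod.splits\<close>; force)+
  then show "\<exists>\<delta>>0. \<forall>I :: (real \<times> real) set.
        finite I \<longrightarrow> (\<forall>(s, t)\<in>I. c \<le> s \<and> s \<le> t \<and> t \<le> d) \<longrightarrow>
        disjoint_family_on (\<lambda>(s, t). {s<..<t}) I \<longrightarrow>
        (\<Sum>(s, t)\<in>I. t - s) < \<delta> \<longrightarrow> (\<Sum>(s, t)\<in>I. dist (w s) (w t)) < e"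
    using \<delta>(1) by blast
qed

lemma abs_continuous_imp_continuous_on:
  assumes "abs_continuous_on a b w"
  shows "continuous_on {a..b} w"
  unfolding continuous_on_iff
proof (intro ballI allI impI)
  fix x e :: real assume x: "x \<in> {a..b}" and "e > 0"
  then obtain \<delta> where \<delta>: "\<delta> > 0" "\<And>I :: (real \<times> real) set. finite I \<Longrightarrow>
        (\<forall>(s, t)\<in>I. a \<le> s \<and> s \<le> t \<and> t \<le> b) \<Longrightarrow> disjoint_family_on (\<lambda>(s, t). {s<..<t}) I \<Longrightarrow>
        (\<Sum>(s, t)\<in>I. t - s) < \<delta> \<Longrightarrow> (\<Sum>(s, t)\<in>I. dist (w s) (w t)) < e"
    using abs_continuous_onE[OF assms] by blast
  have *: "dist (w s) (w t) < e" if "a \<le> s" "s \<le> t" "t \<le> b" "t - s < \<delta>" for s t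
    using \<delta>(2)[of "{(s, t)}"] that by (simp add: disjoint_family_on_def)
  have "dist (w y) (w x) < e" if "y \<in> {a..b}" "dist y x < \<delta>" for y
    using *[of x y] *[of y x] that x by (cases "x \<le> y") (auto simp: dist_real_def dist_commute)
  then show "\<exists>d>0. \<forall>x'\<in>{a..b}. dist x' x < d \<longrightarrow> dist (w x') (w x) < e"
    using \<delta>(1) by blast
qed

text \<open>A substitute for averaging the derivative. If the mean velocity were outside
  \<open>C\<close>, a hyperplane would separate it strictly from \<open>C\<close>; the scalar
  function obtained by pairing with the normal would then have an almost everywhere derivative bound
  that its total increment violates.\<close>

lemma mean_value_closed_convex:
  fixes w :: "real \<Rightarrow> 'a::euclidean_space"
  assumes ab: "a < b" and ac: "abs_continuous_on a b w" and N: "negligible N"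
    and C: "convex C" "closed C"
    and der: "\<And>t. t \<in> {a..b} - N \<Longrightarrow> \<exists>d\<in>C. (w has_vector_derivative d) (at t within {a..b})"
  shows "(w b - w a) /\<^sub>R (b - a) \<in> C"
proof (rule ccontr)
  assume "(w b - w a) /\<^sub>R (b - a) \<notin> C"
  then obtain \<alpha> \<beta> where \<alpha>: "\<alpha> \<bullet> ((w b - w a) /\<^sub>R (b - a)) < \<beta>" "\<And>x. x \<in> C \<Longrightarrow> \<alpha> \<bullet> x > \<beta>"
    using separating_hyperplane_closed_point[OF C] by blast
  define \<phi> where "\<phi> t = - (\<alpha> \<bullet> w t)" for t
  have "\<phi> b - \<phi> a \<le> (- \<beta>) * (b - a)"
  proof (rule abs_continuous_increment_le[OF _ _ N])
    show "abs_continuous_on a b \<phi>"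
    proof (rule abs_continuous_on_compare[OF ac])
      fix s t
      have "dist (\<phi> s) (\<phi> t) = \<bar>\<alpha> \<bullet> (w s - w t)\<bar>"
        by (simp add: \<phi>_def dist_real_def inner_diff_right)
      also have "\<dots> \<le> norm \<alpha> * dist (w s) (w t)"
        using Cauchy_Schwarz_ineq2 by (simp add: dist_norm)
      finally show "dist (\<phi> s) (\<phi> t) \<le> norm \<alpha> * dist (w s) (w t)" .
    qed
    fix t assume "t \<in> {a..b} - N"
    then obtain d where d: "d \<in> C" "(w has_vector_derivative d) (at t within {a..b})" using der by blast
    have "(\<phi> has_vector_derivative (- (\<alpha> \<bullet> d))) (at t within {a..b})"
      unfolding \<phi>_def
      by (intro has_vector_derivative_minus bounded_linear.has_vector_derivative[OF bounded_linear_inner_right] d)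
    then show "\<exists>d\<le>- \<beta>. (\<phi> has_vector_derivative d) (at t within {a..b})"
      using \<alpha>(2)[OF d(1)] by (intro exI[of _ "- (\<alpha> \<bullet> d)"]) auto
  qed (use ab in simp)
  then have "\<beta> * (b - a) \<le> \<alpha> \<bullet> (w b - w a)" by (simp add: \<phi>_def inner_diff_right)
  then have "\<beta> \<le> (\<alpha> \<bullet> (w b - w a)) / (b - a)" using ab by (simp add: pos_le_divide_eq)
  then show False using \<alpha>(1) by (simp add: divide_inverse mult.commute)
qed

text \<open>The preceding lemma on every subinterval, with \<open>C\<close> the closed ball of
  radius \<open>M\<close>.\<close>

lemma bounded_derivative_imp_lipschitz:
  fixes w :: "real \<Rightarrow> 'a::euclidean_space"
  assumes ac: "abs_continuous_on a b w" and N: "negligible N" and M: "M \<ge> 0"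
    and der: "\<And>t. t \<in> {a..b} - N \<Longrightarrow> \<exists>d. norm d \<le> M \<and> (w has_vector_derivative d) (at t within {a..b})"
  shows "M-lipschitz_on {a..b} w"
proof (rule lipschitz_onI)
  have *: "dist (w s) (w t) \<le> M * dist s t" if st: "s \<in> {a..b}" "t \<in> {a..b}" "s < t" for s t
  proof -
    have "(w t - w s) /\<^sub>R (t - s) \<in> cball 0 M"
    proof (rule mean_value_closed_convex[OF st(3) abs_continuous_on_subinterval[OF ac] N])
      fix r assume r: "r \<in> {s..t} - N"
      then obtain d where "norm d \<le> M" "(w has_vector_derivative d) (at r within {a..b})"
        using der[of r] st by auto
      then show "\<exists>d\<in>cball 0 M. (w has_vector_derivative d) (at r within {s..t})"
        using st by (intro bexI[of _ d]) (auto intro: has_vector_derivative_within_subset)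
    qed (use st in auto)
    then have "norm (w t - w s) / (t - s) \<le> M" using st by (simp add: divide_inverse mult.commute)
    then have "norm (w t - w s) \<le> M * (t - s)" using st by (simp add: pos_divide_le_eq)
    then show ?thesis using st by (simp add: dist_norm norm_minus_commute)
  qed
  show "dist (w s) (w t) \<le> M * dist s t" if "s \<in> {a..b}" "t \<in> {a..b}" for s t
    using *[of s t] *[of t s] that by (cases s t rule: linorder_cases) (auto simp: dist_commute)
qed (rule M)

text \<open>Gronwall's inequality in doubling form: on an interval of length 1/(2c) the quantity
  1 + |w| at most doubles.\<close>

lemma linear_growth_bound:
  fixes w :: "real \<Rightarrow> 'a::euclidean_space"
  assumes ac: "abs_continuous_on 0 T w" and N: "negligible N" and c: "c > 0"
    and der: "\<And>t. t \<in> {0..T} - N \<Longrightarrow>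
      \<exists>d s. s \<in> {0..t} \<and> norm d \<le> c * (1 + norm (w s)) \<and> (w has_vector_derivative d) (at t within {0..T})"
    and t: "t \<in> {0..T}" "t \<le> real n / (2 * c)"
  shows "1 + norm (w t) \<le> 2 ^ n * (1 + norm (w 0))"
  using t
proof (induction n arbitrary: t)
  case 0
  then show ?case by simp
next
  case (Suc n)
  define a where "a = real n / (2 * c)"
  have a0: "a \<ge> 0" using c by (simp add: a_def)
  have cont: "continuous_on {0..t} (\<lambda>r. 1 + norm (w r))"
    using abs_continuous_imp_continuous_on[OF ac] Suc.prems
    by (intro continuous_intros) (auto elim: continuous_on_subset)
  \<comment> \<open>Working at the maximum point absorbs the delay: whatever earlier time
    \<open>s\<close> governs the velocity, \<open>1 + norm (w s)\<close> is at most the maximum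
    \<open>M\<close>.\<close>
  obtain r where r: "r \<in> {0..t}" "\<And>s. s \<in> {0..t} \<Longrightarrow> 1 + norm (w s) \<le> 1 + norm (w r)"
    using continuous_attains_sup[OF _ _ cont] Suc.prems by auto
  define M where "M = 1 + norm (w r)"
  have M: "M \<ge> 1" by (simp add: M_def)
  have "M \<le> 2 ^ Suc n * (1 + norm (w 0))"
  proof (cases "r \<le> a")
    case True
    have "M \<le> 2 ^ n * (1 + norm (w 0))"
      unfolding M_def using Suc.IH[of r] r(1) Suc.prems True by (simp add: a_def)
    also have "\<dots> \<le> 2 ^ Suc n * (1 + norm (w 0))" by (intro mult_right_mono) auto
    finally show ?thesis .
  next
    case False
    have "(c * M)-lipschitz_on {0..r} w"
    proof (rule bounded_derivative_imp_lipschitz[OF abs_continuous_on_subinterval[OF ac] N])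
      fix q assume q: "q \<in> {0..r} - N"
      then obtain d s where ds: "s \<in> {0..q}" "norm d \<le> c * (1 + norm (w s))"
        "(w has_vector_derivative d) (at q within {0..T})"
        using der[of q] r Suc.prems by auto
      have "c * (1 + norm (w s)) \<le> c * M"
        unfolding M_def using r ds q c by (intro mult_left_mono) auto
      then show "\<exists>d. norm d \<le> c * M \<and> (w has_vector_derivative d) (at q within {0..r})"
        using ds r Suc.prems by (intro exI[of _ d]) (auto intro: has_vector_derivative_within_subset)
    qed (use c M r Suc.prems in auto)
    \<comment> \<open>The part of \<open>{0..r}\<close> beyond \<open>a\<close> has length at most
      \<open>1 / (2 * c)\<close>, so the curve moves by at most \<open>M / 2\<close> there, and this
      half of \<open>M\<close> is absorbed on the left.\<close>
    then have "dist (w r) (w a) \<le> c * M * dist r a"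
      using False r a0 by (intro lipschitz_onD) auto
    also have "\<dots> \<le> c * M * (1 / (2 * c))"
    proof (rule mult_left_mono)
      have "r - a \<le> real (Suc n) / (2 * c) - a" using r Suc.prems by simp
      also have "\<dots> = 1 / (2 * c)" by (simp add: a_def diff_divide_distrib[symmetric])
      finally show "dist r a \<le> 1 / (2 * c)" using False by (simp add: dist_real_def)
    qed (use c M in simp)
    also have "\<dots> = M / 2" using c by simp
    finally have "norm (w r) \<le> norm (w a) + M / 2"
      by (smt (verit) dist_norm norm_triangle_sub)
    moreover have "1 + norm (w a) \<le> 2 ^ n * (1 + norm (w 0))"
      using Suc.IH[of a] False a0 r Suc.prems by (simp add: a_def)
    ultimately show ?thesis unfolding M_def by (simp add: field_simps)
  qed
  moreover have "1 + norm (w t) \<le> M" unfolding M_def using r(2)[of t] Suc.prems by auto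
  ultimately show ?case by linarith
qed

section \<open>Differentiability of Lipschitz curves\<close>

lemma measure_image_le_of_small_increments:
  fixes h k :: "real \<Rightarrow> real"
  assumes mono: "strict_mono h" and lip: "L-lipschitz_on UNIV h"
    and kh: "\<And>x. k (h x) = x" "\<And>y. h (k y) = y" and k: "continuous_on UNIV k"
    and E: "E \<in> sets borel" "bounded E" and p: "p \<ge> 0"
    and small: "\<And>x d. x \<in> E \<Longrightarrow> d > 0 \<Longrightarrow>
      \<exists>s t. s < t \<and> s \<le> x \<and> x \<le> t \<and> t - s < d \<and> h t - h s \<le> p * (t - s)"
  shows "h ` E \<in> lmeasurable" "measure lebesgue (h ` E) \<le> p * measure lebesgue E"
proof -
  have EL: "E \<in> lmeasurable" using E by (simp add: bounded_set_imp_lmeasurable)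
  have hE: "h ` E = k -` E" using kh by (auto simp: image_iff) (metis)
  have "h ` E \<in> sets borel"
    unfolding hE using measurable_sets_borel[OF borel_measurable_continuous_onI[OF k] E(1)] by simp
  moreover have "bounded (h ` E)"
    using E(2) lip by (meson lipschitz_on_subset lipschitz_on_uniformly_continuous bounded_uniformly_continuous_image subset_UNIV)
  ultimately show hEL: "h ` E \<in> lmeasurable" by (simp add: bounded_set_imp_lmeasurable)
  have main: "measure lebesgue (h ` E) \<le> p * (measure lebesgue E + e)" if e: "e > 0" for e
  proof -
    obtain V where V: "open V" "E \<subseteq> V" "V - E \<in> lmeasurable" "emeasure lebesgue (V - E) < ennreal e"
      using sets_lebesgue_outer_open[OF fmeasurableD[OF EL] e] by blast
    have "V = E \<union> (V - E)" using V by blast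
    then have VL: "V \<in> lmeasurable" using EL V(3) by (metis fmeasurable.Un)
    have "measure lebesgue (V - E) < e"
      using V(3,4) e by (simp add: emeasure_eq_measure2 ennreal_less_iff)
    then have mV: "measure lebesgue V < measure lebesgue E + e"
      using measurable_measure_Diff[OF VL fmeasurableD[OF EL] V(2)] by linarith
    define \<K> where "\<K> = {(s, t). s < t \<and> {s..t} \<subseteq> V \<and> h t - h s \<le> p * (t - s)}"
    \<comment> \<open>The covering theorem is about balls; an interval is encoded by its midpoint
      and half length.\<close>
    define c where "c = (\<lambda>(s, t). (s + t) / 2 :: real)"
    define r where "r = (\<lambda>(s, t). (t - s) / 2 :: real)"
    have cb: "cball (c i) (r i) = {fst i..snd i}" for i
      by (auto simp: c_def r_def cball_eq_atLeastAtMost case_prod_unfold field_simps)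
    obtain \<C> where C: "countable \<C>" "\<C> \<subseteq> \<K>"
      "pairwise (\<lambda>i j. disjnt (cball (c i) (r i)) (cball (c j) (r j))) \<C>"
      "negligible (E - (\<Union>i \<in> \<C>. cball (c i) (r i)))"
    proof (rule Vitali_covering_theorem_cballs[of \<K> r E c])
      show "0 < r i" if "i \<in> \<K>" for i using that by (auto simp: \<K>_def r_def)
      fix x d :: real assume x: "x \<in> E" and d: "d > 0"
      obtain \<eta> where \<eta>: "\<eta> > 0" "ball x \<eta> \<subseteq> V" using V x by (meson openE subsetD)
      obtain s t where st: "s < t" "s \<le> x" "x \<le> t" "t - s < min d \<eta>" "h t - h s \<le> p * (t - s)"
        using small[OF x, of "min d \<eta>"] d \<eta> by auto
      have "{s..t} \<subseteq> ball x \<eta>" using st by (auto simp: dist_real_def)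
      then have "(s, t) \<in> \<K>" using st \<eta> by (auto simp: \<K>_def)
      moreover have "x \<in> cball (c (s, t)) (r (s, t))" using st cb by simp
      moreover have "r (s, t) < d" using st by (simp add: r_def)
      ultimately show "\<exists>i. i \<in> \<K> \<and> x \<in> cball (c i) (r i) \<and> r i < d" by blast
    qed blast
    define R where "R = E - (\<Union>i\<in>\<C>. {fst i..snd i})"
    have "negligible R" using C(4) by (simp add: R_def cb)
    then have hR: "negligible (h ` R)"
    proof (rule negligible_locally_Lipschitz_image[rotated])
      fix x
      show "\<exists>T B. open T \<and> x \<in> T \<and> (\<forall>y\<in>R \<inter> T. norm (h y - h x) \<le> B * norm (y - x))"
        using lipschitz_onD[OF lip] by (intro exI[of _ UNIV] exI[of _ L]) (auto simp: dist_norm)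
    qed simp
    have disj: "snd i < fst j \<or> snd j < fst i" if "i \<in> \<C>" "j \<in> \<C>" "i \<noteq> j" for i j
    proof -
      have "{fst i..snd i} \<inter> {fst j..snd j} = {}" using C(3) that unfolding pairwise_def disjnt_def cb by blast
      moreover have "fst i < snd i" "fst j < snd j" using that C(2) by (auto simp: \<K>_def)
      ultimately show ?thesis by auto
    qed
    have C': "fst i < snd i" "{fst i..snd i} \<subseteq> V" "h (snd i) - h (fst i) \<le> p * (snd i - fst i)" if "i \<in> \<C>" for i
      using that C(2) by (auto simp: \<K>_def case_prod_unfold)
    have "h ` E \<subseteq> (\<Union>i\<in>\<C>. {h (fst i)..h (snd i)}) \<union> h ` R"
    proof clarify
      fix x assume "x \<in> E" "h x \<notin> h ` R"
      then have "x \<in> E" "x \<notin> R" by blast+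
      then obtain i where "i \<in> \<C>" "x \<in> {fst i..snd i}" unfolding R_def by blast
      then show "h x \<in> (\<Union>i\<in>\<C>. {h (fst i)..h (snd i)})"
        using mono by (auto simp: strict_mono_less_eq intro!: bexI[of _ i])
    qed
    then have "emeasure lebesgue (h ` E) \<le> emeasure lebesgue ((\<Union>i\<in>\<C>. {h (fst i)..h (snd i)}) \<union> h ` R)"
      using C(1) hR by (intro emeasure_mono sets.Un sets.countable_UN') (auto simp: negligible_imp_sets)
    also have "\<dots> = emeasure lebesgue (\<Union>i\<in>\<C>. {h (fst i)..h (snd i)})"
      using hR C(1) by (intro emeasure_Un_null_set sets.countable_UN') (auto simp: negligible_iff_null_sets)
    also have "\<dots> = (\<integral>\<^sup>+ i. emeasure lebesgue {h (fst i)..h (snd i)} \<partial>count_space \<C>)"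
    proof (rule emeasure_UN_countable)
      show "disjoint_family_on (\<lambda>i. {h (fst i)..h (snd i)}) \<C>"
        unfolding disjoint_family_on_def
      proof (intro ballI impI)
        fix i j assume "i \<in> \<C>" "j \<in> \<C>" "i \<noteq> j"
        then have "h (snd i) < h (fst j) \<or> h (snd j) < h (fst i)"
          using disj[of i j] mono by (auto simp: strict_mono_less)
        then show "{h (fst i)..h (snd i)} \<inter> {h (fst j)..h (snd j)} = {}" by auto
      qed
    qed (use C(1) in auto)
    also have "\<dots> \<le> (\<integral>\<^sup>+ i. ennreal p * emeasure lebesgue {fst i..snd i} \<partial>count_space \<C>)"
    proof (rule nn_integral_mono)
      fix i assume "i \<in> space (count_space \<C>)"
      then have i: "i \<in> \<C>" by simp
      have "h (fst i) \<le> h (snd i)" using C'(1)[OF i] mono by (simp add: strict_mono_less_eq)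
      then show "emeasure lebesgue {h (fst i)..h (snd i)} \<le> ennreal p * emeasure lebesgue {fst i..snd i}"
        using C'[OF i] p by (simp add: ennreal_mult[symmetric] ennreal_leI)
    qed
    also have "\<dots> = ennreal p * (\<integral>\<^sup>+ i. emeasure lebesgue {fst i..snd i} \<partial>count_space \<C>)"
      by (rule nn_integral_cmult) simp
    also have "(\<integral>\<^sup>+ i. emeasure lebesgue {fst i..snd i} \<partial>count_space \<C>) = emeasure lebesgue (\<Union>i\<in>\<C>. {fst i..snd i})"
    proof (rule emeasure_UN_countable[symmetric])
      show "disjoint_family_on (\<lambda>i. {fst i..snd i}) \<C>"
        unfolding disjoint_family_on_def using disj by fastforce
    qed (use C(1) in auto)
    also have "ennreal p * \<dots> \<le> ennreal p * emeasure lebesgue V"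
      using C'(2) VL by (intro mult_left_mono emeasure_mono) auto
    also have "\<dots> = ennreal (p * measure lebesgue V)"
      using VL p by (simp add: emeasure_eq_measure2 ennreal_mult)
    finally have "measure lebesgue (h ` E) \<le> p * measure lebesgue V"
      using hEL p by (simp add: emeasure_eq_measure2)
    also have "\<dots> \<le> p * (measure lebesgue E + e)" using mV p by (intro mult_left_mono) auto
    finally show ?thesis .
  qed
  show "measure lebesgue (h ` E) \<le> p * measure lebesgue E"
  proof (rule field_le_epsilon)
    fix e :: real assume e: "e > 0"
    have "measure lebesgue (h ` E) \<le> p * (measure lebesgue E + e / (p + 1))"
      using main[of "e / (p + 1)"] e p by simp
    also have "\<dots> \<le> p * measure lebesgue E + e"
      using e p by (simp add: field_simps)
    finally show "measure lebesgue (h ` E) \<le> p * measure lebesgue E + e" .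
  qed
qed

text \<open>Points with difference quotients below \<open>p\<close> at arbitrarily small steps of
  either sign, a countable form of a lower derivative below \<open>p\<close>. Applied to
  \<open>- h\<close> and \<open>- q\<close> it describes quotients of \<open>h\<close> above
  \<open>q\<close>.\<close>

definition slow_points :: "(real \<Rightarrow> real) \<Rightarrow> real \<Rightarrow> real set" where
  "slow_points h p = (\<Inter>m. \<Union>s\<in>{s. s \<noteq> 0 \<and> \<bar>s\<bar> < 1 / real (Suc m)}. {x. (h (x + s) - h x) / s < p})"

text \<open>The union over steps \<open>s\<close> is uncountable, but each member is open by
  continuity, so the whole set is a countable intersection of open sets.\<close>

lemma slow_points_borel:
  assumes "continuous_on UNIV h"
  shows "slow_points h p \<in> sets borel"
proof -
  have "open {x. (h (x + s) - h x) / s < p}" if "s \<noteq> 0" for s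
    by (intro open_Collect_less continuous_intros continuous_on_compose2[OF assms]) (auto simp: that)
  then show ?thesis unfolding slow_points_def by (intro sets.countable_INT image_subsetI borel_open open_UN) auto
qed

text \<open>A step of either sign gives an interval with \<open>x\<close> as an endpoint, which is
  the shape the covering argument takes as input.\<close>

lemma slow_pointsD:
  assumes "x \<in> slow_points h p" "d > 0"
  shows "\<exists>s t. s < t \<and> s \<le> x \<and> x \<le> t \<and> t - s < d \<and> h t - h s \<le> p * (t - s)"
proof -
  obtain m where m: "inverse (real (Suc m)) < d" using reals_Archimedean[OF assms(2)] by blast
  obtain s where s: "s \<noteq> 0" "\<bar>s\<bar> < 1 / real (Suc m)" "(h (x + s) - h x) / s < p"
    using assms(1) by (auto simp: slow_points_def)
  have "\<bar>s\<bar> < d" using s(2) m by (simp add: inverse_eq_divide)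
  show ?thesis
  proof (cases "s > 0")
    case True
    then have "h (x + s) - h x \<le> p * s" using s(3) by (simp add: pos_divide_less_eq)
    then show ?thesis using True \<open>\<bar>s\<bar> < d\<close> by (intro exI[of _ x] exI[of _ "x + s"]) auto
  next
    case False
    then have "s < 0" using s by simp
    then have "h x - h (x + s) \<le> p * (- s)" using s(3) by (simp add: neg_divide_less_eq)
    then show ?thesis using \<open>s < 0\<close> \<open>\<bar>s\<bar> < d\<close> by (intro exI[of _ "x + s"] exI[of _ x]) auto
  qed
qed

lemma not_slow_pointsD:
  assumes "x \<notin> slow_points h p"
  shows "eventually (\<lambda>s. p \<le> (h (x + s) - h x) / s) (at 0)"
proof -
  obtain m where m: "\<And>s. s \<noteq> 0 \<Longrightarrow> \<bar>s\<bar> < 1 / real (Suc m) \<Longrightarrow> p \<le> (h (x + s) - h x) / s"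
  proof -
    obtain m where "x \<notin> (\<Union>s\<in>{s. s \<noteq> 0 \<and> \<bar>s\<bar> < 1 / real (Suc m)}. {x. (h (x + s) - h x) / s < p})"
      using assms unfolding slow_points_def by blast
    then show ?thesis by (intro that[of m]) (force simp: not_less simp del: of_nat_Suc)
  qed
  show ?thesis unfolding eventually_at
    by (intro exI[of _ "1 / real (Suc m)"]) (auto intro!: m simp del: of_nat_Suc)
qed

text \<open>On the set where the lower derivative of \<open>h\<close> is less than \<open>p\<close> and the upper one exceeds
  \<open>q > p\<close>, covering its image by short intervals gives \<open>|h E| \<le> p |E|\<close>, while the same
  argument for the inverse gives \<open>|E| \<le> |h E| / q\<close>.\<close>

lemma negligible_oscillating_derivative:
  fixes h k :: "real \<Rightarrow> real"
  assumes mono: "strict_mono h" and lip: "L-lipschitz_on UNIV h"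
    and kh: "\<And>x. k (h x) = x" "\<And>y. h (k y) = y" and k: "1-lipschitz_on UNIV k"
    and pq: "0 < p" "p < q"
  shows "negligible (slow_points h p \<inter> slow_points (\<lambda>x. - h x) (- q))" (is "negligible ?E")
proof -
  \<comment> \<open>Truncation makes the measures finite, so that the two opposite estimates can be
    chained and cancelled.\<close>
  have "negligible (?E \<inter> {- real n..real n})" for n
  proof -
    define E where "E = ?E \<inter> {- real n..real n}"
    have ch: "continuous_on UNIV h" using lip by (rule lipschitz_on_continuous_on)
    have ck: "continuous_on UNIV k" using k by (rule lipschitz_on_continuous_on)
    have E: "E \<in> sets borel" "bounded E"
      using slow_points_borel[OF ch] slow_points_borel[OF continuous_on_minus[OF ch]]
      by (auto simp: E_def)
    have hE: "h ` E \<in> lmeasurable" and le1: "measure lebesgue (h ` E) \<le> p * measure lebesgue E"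
    proof -
      have small: "\<exists>s t. s < t \<and> s \<le> x \<and> x \<le> t \<and> t - s < d \<and> h t - h s \<le> p * (t - s)"
        if "x \<in> E" "d > 0" for x d
        using that slow_pointsD[of x h p d] by (simp add: E_def)
      show "h ` E \<in> lmeasurable"
        by (rule measure_image_le_of_small_increments(1)[OF mono lip kh ck E _ small]) (use pq in auto)
      show "measure lebesgue (h ` E) \<le> p * measure lebesgue E"
        by (rule measure_image_le_of_small_increments(2)[OF mono lip kh ck E _ small]) (use pq in auto)
    qed
    have kmono: "strict_mono k"
      using mono kh by (intro strict_monoI) (metis strict_mono_less)
    have hE': "h ` E \<in> sets borel" "bounded (h ` E)"
    proof -
      have "h ` E = k -` E" using kh by (auto simp: image_iff) (metis)
      then show "h ` E \<in> sets borel"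
        using measurable_sets_borel[OF borel_measurable_continuous_onI[OF ck] E(1)] by simp
      show "bounded (h ` E)"
        using E(2) lip by (meson lipschitz_on_subset lipschitz_on_uniformly_continuous bounded_uniformly_continuous_image subset_UNIV)
    qed
    have L: "L \<ge> 0" using lip by (rule lipschitz_on_nonneg)
    have "measure lebesgue (k ` h ` E) \<le> (1 / q) * measure lebesgue (h ` E)"
    proof (rule measure_image_le_of_small_increments(2)[OF kmono k kh(2,1) ch hE'])
      fix y d :: real assume "y \<in> h ` E" and d: "d > 0"
      then obtain x where x: "x \<in> E" "y = h x" by blast
      \<comment> \<open>The roles of \<open>h\<close> and \<open>k\<close> are exchanged: the
        interval is shrunk by \<open>L + 1\<close> because \<open>h\<close> may stretch it by
        \<open>L\<close>, and slope at least \<open>q\<close> for \<open>h\<close> is slope at most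
        \<open>1 / q\<close> for \<open>k\<close>.\<close>
      then obtain s t where st: "s < t" "s \<le> x" "x \<le> t" "t - s < d / (L + 1)" "- h t - - h s \<le> - q * (t - s)"
        using slow_pointsD[of x "\<lambda>x. - h x" "- q" "d / (L + 1)"] d L by (auto simp: E_def)
      have "h t - h s \<le> L * (t - s)" using lipschitz_onD[OF lip, of t s] st by (simp add: dist_real_def)
      also have "\<dots> \<le> (L + 1) * (t - s)" using st by simp
      also have "\<dots> < d" using st L by (simp add: field_simps)
      finally have "h t - h s < d" .
      moreover have "k (h t) - k (h s) \<le> 1 / q * (h t - h s)"
        using st pq by (simp add: kh field_simps)
      ultimately show "\<exists>s t. s < t \<and> s \<le> y \<and> y \<le> t \<and> t - s < d \<and> k t - k s \<le> 1 / q * (t - s)"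
        using st mono x by (intro exI[of _ "h s"] exI[of _ "h t"]) (simp add: strict_mono_less strict_mono_less_eq)
    qed (use pq in simp)
    then have le2: "measure lebesgue E \<le> measure lebesgue (h ` E) / q"
      by (simp add: image_image kh)
    have "q * measure lebesgue E \<le> p * measure lebesgue E"
      using le1 le2 pq by (simp add: field_simps)
    then have "(q - p) * measure lebesgue E \<le> 0" by (simp add: algebra_simps)
    then have "measure lebesgue E \<le> 0" using pq by (simp add: mult_le_0_iff)
    then have "measure lebesgue E = 0" using measure_nonneg[of lebesgue E] by linarith
    then show ?thesis using E
      by (simp add: negligible_iff_measure bounded_set_imp_lmeasurable flip: E_def)
  qed
  then have "negligible (\<Union>n. ?E \<inter> {- real n..real n})" by (intro negligible_countable_Union) auto
  moreover have "?E \<subseteq> (\<Union>n. ?E \<inter> {- real n..real n})"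
  proof
    fix x assume "x \<in> ?E"
    moreover obtain n where "\<bar>x\<bar> \<le> real n" using real_arch_simple by blast
    ultimately show "x \<in> (\<Union>n. ?E \<inter> {- real n..real n})" by (auto intro!: exI[of _ n])
  qed
  ultimately show ?thesis by (rule negligible_subset)
qed

text \<open>Adding a linear function turns \<open>\<phi>\<close> into an increasing bi-Lipschitz
  bijection of the line, to which the two-sided measure estimate applies. If the lower and upper
  limits of the difference quotients differ, two rationals fit between them, so the point lies in
  one of countably many null sets.\<close>

lemma lipschitz_real_differentiable_ae:
  fixes \<phi> :: "real \<Rightarrow> real"
  assumes lip: "L-lipschitz_on UNIV \<phi>"
  shows "\<exists>N. negligible N \<and> (\<forall>x. x \<notin> N \<longrightarrow> (\<exists>D. (\<phi> has_real_derivative D) (at x)))"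
proof -
  have L: "L \<ge> 0" using lip by (rule lipschitz_on_nonneg)
  \<comment> \<open>Slopes of \<open>\<phi>\<close> lie between \<open>-L\<close> and
    \<open>L\<close>, hence those of \<open>h\<close> between \<open>1\<close> and
    \<open>2 * L + 1\<close>.\<close>
  define h where "h x = \<phi> x + (L + 1) * x" for x
  have grow: "t - s \<le> h t - h s" if "s \<le> t" for s t
  proof -
    have "\<bar>\<phi> t - \<phi> s\<bar> \<le> L * (t - s)"
      using lipschitz_onD[OF lip, of t s] that by (simp add: dist_real_def)
    then have "- (L * (t - s)) \<le> \<phi> t - \<phi> s" by (rule abs_le_D2[THEN minus_le_iff[THEN iffD1]])
    then show ?thesis by (simp add: h_def algebra_simps)
  qed
  have mono: "strict_mono h"
  proof (rule strict_monoI)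
    fix s t :: real assume "s < t"
    then show "h s < h t" using grow[of s t] by simp
  qed
  have hlip: "(2 * L + 1)-lipschitz_on UNIV h"
  proof (rule lipschitz_onI)
    fix s t
    have "dist (h s) (h t) \<le> \<bar>\<phi> s - \<phi> t\<bar> + \<bar>(L + 1) * (s - t)\<bar>"
      by (simp add: h_def dist_real_def algebra_simps)
    also have "\<dots> \<le> L * dist s t + (L + 1) * dist s t"
      using lipschitz_onD[OF lip, of s t] L by (simp add: dist_real_def abs_mult)
    finally show "dist (h s) (h t) \<le> (2 * L + 1) * dist s t" by (simp add: algebra_simps)
  qed (use L in simp)
  have ch: "continuous_on UNIV h" using hlip by (rule lipschitz_on_continuous_on)
  have "\<exists>x. h x = y" for y
  proof -
    \<comment> \<open>Slope at least 1 guarantees that \<open>h\<close> reaches the value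
      \<open>y\<close> within this distance of 0.\<close>
    define r where "r = \<bar>y - h 0\<bar>"
    have "h (- r) \<le> y" "y \<le> h r" using grow[of 0 r] grow[of "- r" 0] by (auto simp: r_def)
    then show ?thesis
      using IVT'[of h "- r" y r] continuous_on_subset[OF ch] by (auto simp: r_def)
  qed
  then obtain k where hk: "\<And>y. h (k y) = y" by metis
  have kh: "k (h x) = x" for x using strict_mono_eq[OF mono, of "k (h x)" x] hk by simp
  have klip: "1-lipschitz_on UNIV k"
  proof (rule lipschitz_onI)
    fix y z
    show "dist (k y) (k z) \<le> 1 * dist y z"
      using grow[of "k y" "k z"] grow[of "k z" "k y"]
      by (cases "k y \<le> k z") (auto simp: hk dist_real_def)
  qed simp
  \<comment> \<open>Restricting to \<open>0 < p\<close> loses nothing: the quotients of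
    \<open>h\<close> are at least 1, so every rational above their lower limit is positive.\<close>
  define N where "N = (\<Union>(p, q)\<in>{(p, q). p \<in> \<rat> \<and> q \<in> \<rat> \<and> 0 < p \<and> p < q}.
    slow_points h p \<inter> slow_points (\<lambda>x. - h x) (- q))"
  have "negligible N"
  proof -
    have "countable {(p, q). p \<in> \<rat> \<and> q \<in> \<rat> \<and> 0 < p \<and> p < (q::real)}"
      by (rule countable_subset[OF _ countable_SIGMA[OF countable_rat countable_rat]]) auto
    then show ?thesis unfolding N_def
      by (intro negligible_countable_Union countable_image)
        (auto intro!: negligible_oscillating_derivative[OF mono hlip kh hk klip])
  qed
  moreover have "\<exists>D. (\<phi> has_real_derivative D) (at x)" if x: "x \<notin> N" for x
  proof -
    define Q where "Q s = (h (x + s) - h x) / s" for s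
    have Q1: "1 \<le> Q s" "Q s \<le> 2 * L + 1" if "s \<noteq> 0" for s
    proof -
      show "1 \<le> Q s"
        using grow[of x "x + s"] grow[of "x + s" x] that
        by (cases "s > 0") (auto simp: Q_def pos_le_divide_eq neg_le_divide_eq)
      have "\<bar>h (x + s) - h x\<bar> \<le> (2 * L + 1) * \<bar>s\<bar>"
        using lipschitz_onD[OF hlip, of "x + s" x] by (simp add: dist_real_def)
      then have "\<bar>Q s\<bar> \<le> 2 * L + 1" using that by (simp add: Q_def pos_divide_le_eq)
      then show "Q s \<le> 2 * L + 1" by simp
    qed
    have ev: "eventually (\<lambda>s. 1 \<le> Q s \<and> Q s \<le> 2 * L + 1) (at 0)"
      using Q1 by (auto simp: eventually_at intro!: exI[of _ 1])
    define l where "l = Liminf (at 0) (\<lambda>s. ereal (Q s))"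
    define u where "u = Limsup (at 0) (\<lambda>s. ereal (Q s))"
    have l1: "1 \<le> l" unfolding l_def by (rule Liminf_bounded) (use ev in \<open>auto elim: eventually_mono\<close>)
    have u1: "u \<le> ereal (2 * L + 1)"
      unfolding u_def by (rule Limsup_bounded) (use ev in \<open>auto elim: eventually_mono\<close>)
    have lu: "l \<le> u" unfolding l_def u_def by (rule Liminf_le_Limsup) simp
    have "\<not> l < u"
    proof
      assume "l < u"
      then obtain p where p: "l < ereal (of_rat p)" "ereal (of_rat p) < u" using ereal_dense3 by blast
      then obtain q where q: "ereal (of_rat p) < ereal (of_rat q)" "ereal (of_rat q) < u" using ereal_dense3 by blast
      have "ereal 1 < ereal (of_rat p)" using l1 p(1) by (metis one_ereal_def order_le_less_trans)
      then have "1 < (of_rat p :: real)" by simp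
      then have pq: "0 < (of_rat p :: real)" "of_rat p < (of_rat q :: real)" using q by simp_all
      have "x \<in> slow_points h (of_rat p)"
      proof (rule ccontr)
        assume "\<not> ?thesis"
        then have "ereal (of_rat p) \<le> l" unfolding l_def
          by (intro Liminf_bounded) (use not_slow_pointsD in \<open>force elim: eventually_mono simp: Q_def\<close>)
        then show False using p by simp
      qed
      moreover have "x \<in> slow_points (\<lambda>x. - h x) (- of_rat q)"
      proof (rule ccontr)
        assume "\<not> ?thesis"
        then have "eventually (\<lambda>s. - of_rat q \<le> (- h (x + s) - - h x) / s) (at 0)"
          by (rule not_slow_pointsD)
        then have "eventually (\<lambda>s. ereal (Q s) \<le> ereal (of_rat q)) (at 0)"
          by (rule eventually_mono) (simp add: Q_def diff_divide_distrib)
        then have "u \<le> ereal (of_rat q)" unfolding u_def by (rule Limsup_bounded)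
        then show False using q by simp
      qed
      ultimately show False using x pq by (auto simp: N_def)
    qed
    then have "l = u" using lu by simp
    moreover have "\<bar>l\<bar> \<noteq> \<infinity>" using l1 u1 lu by (cases l) auto
    ultimately obtain D where D: "l = ereal D" "u = ereal D" by (cases l) auto
    have "((\<lambda>s. ereal (Q s)) \<longlongrightarrow> ereal D) (at 0)"
      using D by (subst tendsto_iff_Liminf_eq_Limsup) (auto simp: l_def u_def)
    then have "(Q \<longlongrightarrow> D) (at 0)" by simp
    then have "(h has_real_derivative D) (at x)" unfolding DERIV_def by (simp add: Q_def[abs_def])
    then have "((\<lambda>x. h x - (L + 1) * x) has_real_derivative (D - (L + 1))) (at x)"
      by (auto intro!: derivative_eq_intros)
    then show ?thesis by (auto simp: h_def)
  qed
  ultimately show ?thesis by blast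
qed

lemma lipschitz_differentiable_ae:
  fixes w :: "real \<Rightarrow> 'a::euclidean_space"
  assumes lip: "L-lipschitz_on {a..b} w" and ab: "a \<le> b"
  shows "\<exists>N. negligible N \<and> (\<forall>t\<in>{a..b} - N. \<exists>d. (w has_vector_derivative d) (at t within {a..b}))"
proof -
  have L: "L \<ge> 0" using lip by (rule lipschitz_on_nonneg)
  \<comment> \<open>Clamping the time extends the curve to the whole line with the same Lipschitz
    constant, so the real-valued result can be applied to each coordinate.\<close>
  define c where "c t = max a (min b t)" for t
  have c: "c t \<in> {a..b}" "dist (c s) (c t) \<le> dist s t" for s t
    using ab by (auto simp: c_def dist_real_def)
  have "L-lipschitz_on UNIV (\<lambda>t. w (c t) \<bullet> i)" if "i \<in> Basis" for i
  proof (rule lipschitz_onI)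
    fix s t
    have "dist (w (c s) \<bullet> i) (w (c t) \<bullet> i) \<le> dist (w (c s)) (w (c t))"
      using that by (simp add: dist_real_def dist_norm Basis_le_norm flip: inner_diff_left)
    also have "\<dots> \<le> L * dist (c s) (c t)" using lipschitz_onD[OF lip] c by blast
    also have "\<dots> \<le> L * dist s t" using c L by (intro mult_left_mono)
    finally show "dist (w (c s) \<bullet> i) (w (c t) \<bullet> i) \<le> L * dist s t" .
  qed (rule L)
  then have "\<forall>i\<in>Basis. \<exists>N. negligible N \<and> (\<forall>x. x \<notin> N \<longrightarrow> (\<exists>D. ((\<lambda>t. w (c t) \<bullet> i) has_real_derivative D) (at x)))"
    using lipschitz_real_differentiable_ae by blast
  then obtain N where N: "\<And>i. i \<in> Basis \<Longrightarrow> negligible (N i)"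
    "\<And>i x. i \<in> Basis \<Longrightarrow> x \<notin> N i \<Longrightarrow> \<exists>D. ((\<lambda>t. w (c t) \<bullet> i) has_real_derivative D) (at x)"
    by metis
  have "negligible (\<Union>i\<in>Basis. N i)" using N(1) by (intro negligible_Union) auto
  moreover have "\<exists>d. (w has_vector_derivative d) (at t within {a..b})" if t: "t \<in> {a..b} - (\<Union>i\<in>Basis. N i)" for t
  proof -
    have "\<forall>i\<in>Basis. \<exists>D. ((\<lambda>t. w (c t) \<bullet> i) has_real_derivative D) (at t)" using N(2) t by blast
    from bchoice[OF this] obtain D
      where D: "\<forall>i\<in>Basis. ((\<lambda>t. w (c t) \<bullet> i) has_real_derivative D i) (at t)" ..
    have "((\<lambda>t. w (c t)) has_vector_derivative (\<Sum>i\<in>Basis. D i *\<^sub>R i)) (at t within {a..b})"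
    proof -
      have "((\<lambda>t. \<Sum>i\<in>Basis. (w (c t) \<bullet> i) *\<^sub>R i) has_vector_derivative (\<Sum>i\<in>Basis. D i *\<^sub>R i)) (at t within {a..b})"
      proof (rule has_vector_derivative_sum[where f = "\<lambda>i t. (w (c t) \<bullet> i) *\<^sub>R i" and f' = "\<lambda>i. D i *\<^sub>R i"])
        fix i :: 'a assume "i \<in> Basis"
        then have "((\<lambda>t. w (c t) \<bullet> i) has_vector_derivative D i) (at t within {a..b})"
          using D by (simp add: has_real_derivative_iff_has_vector_derivative has_vector_derivative_at_within)
        then show "((\<lambda>t. (w (c t) \<bullet> i) *\<^sub>R i) has_vector_derivative D i *\<^sub>R i) (at t within {a..b})"
          by (rule bounded_linear.has_vector_derivative[OF bounded_linear_scaleR_left])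
      qed
      then show ?thesis by (simp add: euclidean_representation)
    qed
    moreover have "w (c s) = w s" if "s \<in> {a..b}" for s using that by (simp add: c_def)
    ultimately show ?thesis using t by (metis (no_types, lifting) DiffD1 has_vector_derivative_transform)
  qed
  ultimately show ?thesis by blast
qed

section \<open>Measurable selection\<close>

text \<open>On a compact set a nonnegative continuous function has a zero as soon as its infimum is
  0, and the infimum can be read off from a countable dense subset. This turns the uncountable
  quantifier into countable set operations.\<close>

lemma measurable_zero_exists:
  fixes K :: "'a::euclidean_space set" and h :: "'t \<Rightarrow> 'a \<Rightarrow> real"
  assumes K: "compact K" and nonneg: "\<And>t u. t \<in> space M \<Longrightarrow> u \<in> K \<Longrightarrow> 0 \<le> h t u"
    and meas: "\<And>u. u \<in> K \<Longrightarrow> (\<lambda>t. h t u) \<in> borel_measurable M"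
    and cont: "\<And>t. t \<in> space M \<Longrightarrow> continuous_on K (h t)"
  shows "{t \<in> space M. \<exists>u\<in>K. h t u = 0} \<in> sets M"
proof -
  obtain Q where Q: "countable Q" "Q \<subseteq> K" "K \<subseteq> closure Q" using separable by blast
  have "{t \<in> space M. \<exists>u\<in>K. h t u = 0} = (\<Inter>m. \<Union>q\<in>Q. {t \<in> space M. h t q < 1 / real (Suc m)})" (is "?L = ?R")
  proof (rule subset_antisym)
    show "?L \<subseteq> ?R"
    proof
      fix t assume "t \<in> ?L"
      then obtain u where t: "t \<in> space M" and u: "u \<in> K" "h t u = 0" by blast
      have "\<exists>q\<in>Q. h t q < 1 / real (Suc m)" for m
      proof -
        obtain d where d: "d > 0" "\<And>v. v \<in> K \<Longrightarrow> dist v u < d \<Longrightarrow> dist (h t v) (h t u) < 1 / real (Suc m)"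
          using cont[OF t] u(1) unfolding continuous_on_iff by (metis of_nat_0_less_iff zero_less_Suc zero_less_divide_1_iff)
        obtain q where q: "q \<in> Q" "dist q u < d" using Q(3) u(1) d(1) by (meson closure_approachable subsetD)
        then have "dist (h t q) (h t u) < 1 / real (Suc m)" using d(2) Q(2) by blast
        then show ?thesis using q u by (intro bexI[of _ q]) (auto simp: dist_real_def)
      qed
      then show "t \<in> ?R" using t by blast
    qed
    show "?R \<subseteq> ?L"
    proof
      fix t assume t: "t \<in> ?R"
      then have tM: "t \<in> space M" by blast
      have q: "\<exists>q\<in>Q. h t q < 1 / real (Suc m)" for m using t by blast
      then have "K \<noteq> {}" using Q(2) by blast
      then obtain u where u: "u \<in> K" "\<And>v. v \<in> K \<Longrightarrow> h t u \<le> h t v"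
        using continuous_attains_inf[OF K _ cont[OF tM]] by blast
      have "h t u \<le> 0"
      proof (rule ccontr)
        assume "\<not> ?thesis"
        then obtain m where "inverse (real (Suc m)) < h t u" using reals_Archimedean[of "h t u"] by auto
        moreover obtain v where "v \<in> Q" "h t v < 1 / real (Suc m)" using q by blast
        ultimately show False using u(2)[of v] Q(2) by (auto simp: inverse_eq_divide)
      qed
      then show "t \<in> ?L" using nonneg[OF tM u(1)] u(1) tM by (intro CollectI conjI bexI[of _ u]) auto
    qed
  qed
  also have "\<dots> \<in> sets M"
  proof (intro sets.countable_INT image_subsetI)
    fix m
    have "{t \<in> space M. h t q < 1 / real (Suc m)} \<in> sets M" if "q \<in> Q" for q
      using meas[of q] that Q(2) by (auto simp: borel_measurable_iff_less)
    then show "(\<Union>q\<in>Q. {t \<in> space M. h t q < 1 / real (Suc m)}) \<in> sets M"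
      using Q(1) by (intro sets.countable_UN') auto
  qed auto
  finally show ?thesis .
qed

text \<open>The witness is the least value of \<open>u \<bullet> b\<close> over the zeros
  \<open>u\<close>. It is at most \<open>a\<close> exactly when a zero exists in the compact set cut
  out of \<open>U\<close> by a half space, so its sublevel sets are measurable by the preceding
  lemma.\<close>

lemma measurable_min_coordinate:
  fixes U :: "'a::euclidean_space set" and h :: "'t \<Rightarrow> 'a \<Rightarrow> real"
  assumes U: "compact U" and nonneg: "\<And>t u. t \<in> space M \<Longrightarrow> u \<in> U \<Longrightarrow> 0 \<le> h t u"
    and meas: "\<And>u. u \<in> U \<Longrightarrow> (\<lambda>t. h t u) \<in> borel_measurable M"
    and cont: "\<And>t. t \<in> space M \<Longrightarrow> continuous_on U (h t)"
    and ex: "\<And>t. t \<in> space M \<Longrightarrow> \<exists>u\<in>U. h t u = 0"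
  shows "\<exists>m\<in>borel_measurable M. \<forall>t\<in>space M. \<exists>u\<in>U. h t u = 0 \<and> u \<bullet> b = (m t :: real)"
proof -
  have min: "\<exists>u\<in>U. h t u = 0 \<and> (\<forall>v\<in>U. h t v = 0 \<longrightarrow> u \<bullet> b \<le> v \<bullet> b)" if t: "t \<in> space M" for t
  proof -
    have "closedin (top_of_set U) (U \<inter> h t -` {0})"
      using cont[OF t] by (rule continuous_closedin_preimage) simp
    also have "U \<inter> h t -` {0} = {u \<in> U. h t u \<in> {0}}" by auto
    finally have "compact {u \<in> U. h t u \<in> {0}}"
      using U closedin_compact by blast
    moreover have "{u \<in> U. h t u \<in> {0}} \<noteq> {}" using ex[OF t] by blast
    moreover have "continuous_on {u \<in> U. h t u \<in> {0}} (\<lambda>u. u \<bullet> b)" by (intro continuous_intros)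
    ultimately show ?thesis using continuous_attains_inf[of "{u \<in> U. h t u \<in> {0}}" "\<lambda>u. u \<bullet> b"] by auto
  qed
  define m where "m t = Inf ((\<lambda>u. u \<bullet> b) ` {u \<in> U. h t u = 0})" for t
  have m: "\<exists>u\<in>U. h t u = 0 \<and> u \<bullet> b = m t" "\<And>v. v \<in> U \<Longrightarrow> h t v = 0 \<Longrightarrow> m t \<le> v \<bullet> b" if t: "t \<in> space M" for t
  proof -
    obtain u where u: "u \<in> U" "h t u = 0" "\<forall>v\<in>U. h t v = 0 \<longrightarrow> u \<bullet> b \<le> v \<bullet> b" using min[OF t] by blast
    have "m t = u \<bullet> b" unfolding m_def by (rule cInf_eq_minimum) (use u in auto)
    then show "\<exists>u\<in>U. h t u = 0 \<and> u \<bullet> b = m t" "\<And>v. v \<in> U \<Longrightarrow> h t v = 0 \<Longrightarrow> m t \<le> v \<bullet> b"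
      using u by auto
  qed
  have "m \<in> borel_measurable M"
    unfolding borel_measurable_iff_le
  proof
    fix a :: real
    have "{t \<in> space M. m t \<le> a} = {t \<in> space M. \<exists>u\<in>U \<inter> {u. u \<bullet> b \<le> a}. h t u = 0}"
      using m by (auto; force)
    also have "\<dots> \<in> sets M"
    proof (rule measurable_zero_exists)
      have "closed {u. u \<bullet> b \<le> a}" by (intro closed_Collect_le continuous_intros)
      then show "compact (U \<inter> {u. u \<bullet> b \<le> a})" using U by (rule compact_Int_closed[rotated])
      show "continuous_on (U \<inter> {u. u \<bullet> b \<le> a}) (h t)" if "t \<in> space M" for t
        using cont[OF that] by (rule continuous_on_subset) auto
    qed (use nonneg meas in auto)
    finally show "{t \<in> space M. m t \<le> a} \<in> sets M" .
  qed
  then show ?thesis using m(1) by blast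
qed

text \<open>The selection is the lexicographically smallest zero. Fixing a coordinate to its measurable
  minimum keeps the problem in the same form, with the deviation added to \<open>h\<close>.\<close>

lemma measurable_zero_selection:
  fixes U :: "'a::euclidean_space set" and h :: "'t \<Rightarrow> 'a \<Rightarrow> real"
  assumes U: "compact U" and nonneg: "\<And>t u. t \<in> space M \<Longrightarrow> u \<in> U \<Longrightarrow> 0 \<le> h t u"
    and meas: "\<And>u. u \<in> U \<Longrightarrow> (\<lambda>t. h t u) \<in> borel_measurable M"
    and cont: "\<And>t. t \<in> space M \<Longrightarrow> continuous_on U (h t)"
    and ex: "\<And>t. t \<in> space M \<Longrightarrow> \<exists>u\<in>U. h t u = 0"
  obtains v where "v \<in> borel_measurable M" "\<And>t. t \<in> space M \<Longrightarrow> v t \<in> U \<and> h t (v t) = 0"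
proof -
  have "\<exists>m. (\<forall>i\<in>I. m i \<in> borel_measurable M) \<and>
      (\<forall>t\<in>space M. \<exists>u\<in>U. h t u = 0 \<and> (\<forall>i\<in>I. u \<bullet> i = (m i t :: real)))" if "finite I" for I :: "'a set"
    using that
  proof (induction I)
    case empty
    then show ?case using ex by auto
  next
    case (insert j I)
    then obtain m where m: "\<And>i. i \<in> I \<Longrightarrow> m i \<in> borel_measurable M"
      "\<And>t. t \<in> space M \<Longrightarrow> \<exists>u\<in>U. h t u = 0 \<and> (\<forall>i\<in>I. u \<bullet> i = (m i t :: real))" by blast
    define k where "k t u = h t u + (\<Sum>i\<in>I. \<bar>u \<bullet> i - m i t\<bar>)" for t u
    have k0: "k t u = 0 \<longleftrightarrow> h t u = 0 \<and> (\<forall>i\<in>I. u \<bullet> i = m i t)" if "t \<in> space M" "u \<in> U" for t u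
    proof -
      have "k t u = 0 \<longleftrightarrow> h t u = 0 \<and> (\<Sum>i\<in>I. \<bar>u \<bullet> i - m i t\<bar>) = 0"
        unfolding k_def by (rule add_nonneg_eq_0_iff) (use nonneg that in \<open>auto intro: sum_nonneg\<close>)
      also have "(\<Sum>i\<in>I. \<bar>u \<bullet> i - m i t\<bar>) = 0 \<longleftrightarrow> (\<forall>i\<in>I. u \<bullet> i = m i t)"
        using insert.hyps(1) by (subst sum_nonneg_eq_0_iff) auto
      finally show ?thesis .
    qed
    have "\<exists>r\<in>borel_measurable M. \<forall>t\<in>space M. \<exists>u\<in>U. k t u = 0 \<and> u \<bullet> j = (r t :: real)"
    proof (rule measurable_min_coordinate[OF U])
      show "0 \<le> k t u" if "t \<in> space M" "u \<in> U" for t u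
        unfolding k_def using nonneg[OF that] by (intro add_nonneg_nonneg sum_nonneg) auto
      show "(\<lambda>t. k t u) \<in> borel_measurable M" if "u \<in> U" for u
        unfolding k_def using meas[OF that] m(1)
        by (intro borel_measurable_add borel_measurable_sum borel_measurable_abs borel_measurable_diff) auto
      show "continuous_on U (k t)" if "t \<in> space M" for t
        unfolding k_def using cont[OF that] by (intro continuous_intros)
      show "\<exists>u\<in>U. k t u = 0" if "t \<in> space M" for t
        using m(2)[OF that] k0[OF that] by blast
    qed
    then obtain r where r: "r \<in> borel_measurable M" "\<And>t. t \<in> space M \<Longrightarrow> \<exists>u\<in>U. k t u = 0 \<and> u \<bullet> j = r t"
      by blast
    define m' where "m' = m(j := r)"
    have "\<forall>i\<in>insert j I. m' i \<in> borel_measurable M" using m(1) r(1) by (auto simp: m'_def)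
    moreover have "\<exists>u\<in>U. h t u = 0 \<and> (\<forall>i\<in>insert j I. u \<bullet> i = m' i t)" if t: "t \<in> space M" for t
    proof -
      obtain u where u: "u \<in> U" "k t u = 0" "u \<bullet> j = r t" using r(2)[OF t] by blast
      then have "h t u = 0" "\<forall>i\<in>I. u \<bullet> i = m i t" using k0[OF t u(1)] by auto
      then show ?thesis using u insert.hyps(2) by (intro bexI[of _ u]) (auto simp: m'_def)
    qed
    ultimately show ?case by blast
  qed
  from this[OF finite_Basis] obtain m where m: "\<And>i. i \<in> Basis \<Longrightarrow> m i \<in> borel_measurable M"
    "\<And>t. t \<in> space M \<Longrightarrow> \<exists>u\<in>U. h t u = 0 \<and> (\<forall>i\<in>Basis. u \<bullet> i = (m i t :: real))" by blast
  define v where "v t = (\<Sum>i\<in>Basis. m i t *\<^sub>R i)" for t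
  show ?thesis
  proof (rule that[of v])
    show "v \<in> borel_measurable M" unfolding v_def[abs_def]
      by (intro borel_measurable_sum borel_measurable_scaleR m(1)) auto
    fix t assume "t \<in> space M"
    then obtain u where u: "u \<in> U" "h t u = 0" "\<forall>i\<in>Basis. u \<bullet> i = m i t" using m(2) by blast
    have "v t = (\<Sum>i\<in>Basis. (u \<bullet> i) *\<^sub>R i)" unfolding v_def by (rule sum.cong) (use u in auto)
    then have "v t = u" by (simp add: euclidean_representation)
    then show "v t \<in> U \<and> h t (v t) = 0" using u by simp
  qed
qed

section \<open>Filippov's selection lemma\<close>

lemma has_vector_derivative_imp_quotient_tendsto:
  fixes w :: "real \<Rightarrow> 'a::real_normed_vector"
  assumes "(w has_vector_derivative e) (at t within S)"
  shows "((\<lambda>s. (1 / (s - t)) *\<^sub>R (w s - w t)) \<longlongrightarrow> e) (at t within S)"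
proof -
  have "((\<lambda>s. (1 / norm (s - t)) *\<^sub>R (w s - (w t + (s - t) *\<^sub>R e))) \<longlongrightarrow> 0) (at t within S)"
    using assms by (simp add: has_vector_derivative_def has_derivative_within)
  then have "((\<lambda>s. norm ((1 / norm (s - t)) *\<^sub>R (w s - (w t + (s - t) *\<^sub>R e)))) \<longlongrightarrow> 0) (at t within S)"
    by (rule tendsto_norm_zero)
  then have "((\<lambda>s. norm ((1 / (s - t)) *\<^sub>R (w s - w t) - e)) \<longlongrightarrow> 0) (at t within S)"
  proof (rule Lim_transform_within[OF _ zero_less_one])
    fix s assume "0 < dist s t"
    then have "s \<noteq> t" by auto
    then have "w s - (w t + (s - t) *\<^sub>R e) = (s - t) *\<^sub>R ((1 / (s - t)) *\<^sub>R (w s - w t) - e)"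
      by (simp add: scaleR_diff_right)
    then show "norm ((1 / norm (s - t)) *\<^sub>R (w s - (w t + (s - t) *\<^sub>R e))) = norm ((1 / (s - t)) *\<^sub>R (w s - w t) - e)"
      using \<open>s \<noteq> t\<close> by (simp del: scaleR_scaleR)
  qed
  then show ?thesis by (rule Lim_null[THEN iffD2, OF tendsto_norm_zero_cancel])
qed

text \<open>The velocity is a pointwise limit of continuous difference quotients and hence
  measurable. A control producing it is a zero of the distance between \<open>F (w t, u)\<close> and
  that velocity, so measurable selection of zeros applies.\<close>

lemma filippov_selection:
  fixes F :: "'b::euclidean_space \<times> 'c::euclidean_space \<Rightarrow> 'b" and w :: "real \<Rightarrow> 'b"
  assumes F: "continuous_on (D \<times> U) F" and U: "compact U" "U \<noteq> {}"
    and w: "continuous_on {0..\<tau>} w" and N: "negligible N"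
    and incl: "\<And>t. t \<in> {0..\<tau>} - N \<Longrightarrow>
      w t \<in> D \<and> (\<exists>u\<in>U. (w has_vector_derivative F (w t, u)) (at t within {0..\<tau>}))"
  obtains u where "u \<in> borel_measurable (lebesgue_on {0..\<tau>})" "\<And>t. t \<in> {0..\<tau>} \<Longrightarrow> u t \<in> U"
    "AE t in lebesgue_on {0..\<tau>}. (w has_vector_derivative F (w t, u t)) (at t within {0..\<tau>})"
proof -
  \<comment> \<open>The right endpoint is dropped because the quotients look forward in
    time.\<close>
  define S where "S = {0..\<tau>} - (N \<union> {\<tau>})"
  have N': "negligible (N \<union> {\<tau>})" using N by simp
  have S: "S \<in> sets lebesgue" unfolding S_def using N' by (intro sets.Diff) (auto simp: negligible_imp_sets)
  \<comment> \<open>The minimum keeps the argument in the interval on which \<open>w\<close> is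
    continuous; at a fixed \<open>t < \<tau>\<close> it is eventually inactive.\<close>
  define q where "q n t = real (Suc n) *\<^sub>R (w (min \<tau> (t + 1 / real (Suc n))) - w t)" for n t
  define d where "d t = lim (\<lambda>n. q n t)" for t
  have cw: "continuous_on S w" using w by (rule continuous_on_subset) (auto simp: S_def)
  have dm: "d \<in> borel_measurable (lebesgue_on S)"
    unfolding d_def
  proof (rule borel_measurable_lim_metric)
    fix n
    have "continuous_on S (q n)" unfolding q_def
    proof (intro continuous_intros cw continuous_on_compose2[OF w])
      show "(\<lambda>t. min \<tau> (t + 1 / real (Suc n))) ` S \<subseteq> {0..\<tau>}" by (auto simp: S_def)
    qed
    then show "q n \<in> borel_measurable (lebesgue_on S)"
      using S by (rule continuous_imp_measurable_on_sets_lebesgue)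
  qed
  have deq: "d t = e" if t: "t \<in> S" and e: "(w has_vector_derivative e) (at t within {0..\<tau>})" for t e
  proof -
    have t': "0 \<le> t" "t < \<tau>" using t by (auto simp: S_def)
    have lim: "((\<lambda>s. (1 / (s - t)) *\<^sub>R (w s - w t)) \<longlongrightarrow> e) (at t within {0..\<tau>})"
      using e by (rule has_vector_derivative_imp_quotient_tendsto)
    have ev: "eventually (\<lambda>n. t + 1 / real (Suc n) < \<tau>) sequentially"
    proof -
      have "(\<lambda>n. t + 1 / real (Suc n)) \<longlonglongrightarrow> t + 0"
        by (intro tendsto_intros LIMSEQ_Suc[OF lim_1_over_n])
      then show ?thesis using t' by (intro order_tendstoD(2)) auto
    qed
    have "filterlim (\<lambda>n. t + 1 / real (Suc n)) (at t within {0..\<tau>}) sequentially"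
      unfolding filterlim_at
    proof
      show "eventually (\<lambda>n. t + 1 / real (Suc n) \<in> {0..\<tau>} \<and> t + 1 / real (Suc n) \<noteq> t) sequentially"
        using ev by (rule eventually_mono) (use t' in \<open>auto simp: add_nonneg_nonneg\<close>)
      have "(\<lambda>n. t + 1 / real (Suc n)) \<longlonglongrightarrow> t + 0"
        by (intro tendsto_intros LIMSEQ_Suc[OF lim_1_over_n])
      then show "(\<lambda>n. t + 1 / real (Suc n)) \<longlonglongrightarrow> t" by simp
    qed
    from filterlim_compose[OF lim this]
    have "(\<lambda>n. real (Suc n) *\<^sub>R (w (t + 1 / real (Suc n)) - w t)) \<longlonglongrightarrow> e" by simp
    moreover have "eventually (\<lambda>n. real (Suc n) *\<^sub>R (w (t + 1 / real (Suc n)) - w t) = q n t) sequentially"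
      using ev by (rule eventually_mono) (simp add: q_def min_def del: of_nat_Suc)
    ultimately have "(\<lambda>n. q n t) \<longlonglongrightarrow> e" by (rule Lim_transform_eventually)
    then show ?thesis unfolding d_def by (rule limI)
  qed
  define h where "h t u = dist (F (w t, u)) (d t)" for t u
  have wD: "w t \<in> D" if "t \<in> S" for t using incl that by (auto simp: S_def)
  obtain v where v: "v \<in> borel_measurable (lebesgue_on S)" "\<And>t. t \<in> S \<Longrightarrow> v t \<in> U \<and> h t (v t) = 0"
  proof (rule measurable_zero_selection[OF U(1), of "lebesgue_on S" h])
    show "(\<lambda>t. h t u) \<in> borel_measurable (lebesgue_on S)" if "u \<in> U" for u
    proof -
      have "continuous_on S (\<lambda>t. F (w t, u))"
        by (rule continuous_on_compose2[OF F]) (use cw wD that in \<open>auto intro!: continuous_intros\<close>)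
      then have "(\<lambda>t. F (w t, u)) \<in> borel_measurable (lebesgue_on S)"
        using S by (rule continuous_imp_measurable_on_sets_lebesgue)
      then show ?thesis unfolding h_def using dm by (rule borel_measurable_dist)
    qed
    show "continuous_on U (h t)" if "t \<in> space (lebesgue_on S)" for t
    proof -
      have "continuous_on U (\<lambda>u. F (w t, u))"
        by (rule continuous_on_compose2[OF F]) (use wD that in \<open>auto intro!: continuous_intros\<close>)
      then show ?thesis unfolding h_def by (intro continuous_intros)
    qed
    show "\<exists>u\<in>U. h t u = 0" if "t \<in> space (lebesgue_on S)" for t
    proof -
      have t: "t \<in> S" using that by simp
      then obtain u where "u \<in> U" "(w has_vector_derivative F (w t, u)) (at t within {0..\<tau>})"
        using incl[of t] by (auto simp: S_def)
      then show ?thesis using deq[OF t] by (intro bexI[of _ u]) (auto simp: h_def)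
    qed
  qed (auto simp: h_def)
  \<comment> \<open>A default value on the complement of \<open>S\<close>, since a control must lie
    in \<open>U\<close> at every time and not just almost every time.\<close>
  obtain u0 where u0: "u0 \<in> U" using U(2) by blast
  define u where "u t = indicator S t *\<^sub>R v t + indicator (- S) t *\<^sub>R u0" for t
  have uS: "u t = v t" if "t \<in> S" for t using that by (simp add: u_def)
  have unS: "u t = u0" if "t \<notin> S" for t using that by (simp add: u_def)
  show ?thesis
  proof (rule that[of u])
    have "(\<lambda>t. indicator S t *\<^sub>R v t) \<in> borel_measurable lebesgue"
      using v(1) S by (subst (asm) borel_measurable_restrict_space_iff) auto
    moreover have "(\<lambda>t. indicator (- S) t *\<^sub>R u0) \<in> borel_measurable lebesgue"
    proof -
      have "- S \<in> sets lebesgue" using sets.compl_sets[OF S] by (simp add: Compl_eq_Diff_UNIV)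
      then show ?thesis by (intro borel_measurable_scaleR borel_measurable_indicator) auto
    qed
    ultimately have "u \<in> borel_measurable lebesgue"
      unfolding u_def[abs_def] by (rule borel_measurable_add)
    then show "u \<in> borel_measurable (lebesgue_on {0..\<tau>})" by (rule measurable_restrict_space1)
    show "u t \<in> U" for t using uS unS v(2) u0 by (cases "t \<in> S") auto
    have "(w has_vector_derivative F (w t, u t)) (at t within {0..\<tau>})" if "t \<in> {0..\<tau>} - (N \<union> {\<tau>})" for t
    proof -
      have t: "t \<in> S" using that by (simp add: S_def)
      then obtain u' where u': "u' \<in> U" "(w has_vector_derivative F (w t, u')) (at t within {0..\<tau>})"
        using incl[of t] by (auto simp: S_def)
      have "F (w t, v t) = d t" using v(2)[OF t] by (simp add: h_def)
      also have "d t = F (w t, u')" using deq[OF t u'(2)] .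
      finally show ?thesis using u' uS[OF t] by simp
    qed
    then show "AE t in lebesgue_on {0..\<tau>}. (w has_vector_derivative F (w t, u t)) (at t within {0..\<tau>})"
      unfolding AE_lebesgue_on_negligible_iff[OF sets_lebesgue_Icc] using N' by blast
  qed
qed

section \<open>Compactness of trajectories\<close>

text \<open>\<open>H\<close> is arbitrary: on each step the velocity is frozen at the value taken at
  the last node, at most \<open>h\<close> earlier. The constant \<open>L\<close> depends on the
  number of steps and only yields absolute continuity; a uniform constant comes later from the
  growth bound.\<close>

lemma euler_polygon:
  fixes H :: "'a::euclidean_space \<Rightarrow> 'a"
  assumes h: "h > 0"
  shows "\<exists>w L N. w 0 = w0 \<and> L-lipschitz_on {0..real n * h} w \<and> finite N \<and>
    (\<forall>t\<in>{0..real n * h} - N. \<exists>s\<in>{0..t}. t - s \<le> h \<and> (w has_vector_derivative H (w s)) (at t))"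
proof (induction n)
  case 0
  have "0-lipschitz_on {0..real 0 * h} (\<lambda>t. w0)" by (rule lipschitz_onI) auto
  then show ?case by (intro exI[of _ "\<lambda>t. w0"] exI[of _ 0] exI[of _ "{0}"]) auto
next
  case (Suc n)
  define a where "a = real n * h"
  have a: "a \<ge> 0" "real (Suc n) * h = a + h" using h by (auto simp: a_def algebra_simps)
  obtain w L N where w: "w 0 = w0" "L-lipschitz_on {0..a} w" "finite N"
    "\<And>t. t \<in> {0..a} - N \<Longrightarrow> \<exists>s\<in>{0..t}. t - s \<le> h \<and> (w has_vector_derivative H (w s)) (at t)"
    using Suc unfolding a_def by blast
  define l where "l t = w a + (t - a) *\<^sub>R H (w a)" for t
  define v where "v t = (if t \<le> a then w t else l t)" for t
  have "(norm (H (w a)))-lipschitz_on {a..a + h} l"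
    by (rule lipschitz_onI) (auto simp: l_def dist_norm algebra_simps simp flip: scaleR_diff_left)
  then have "(max L (norm (H (w a))))-lipschitz_on {0..a + h} v"
    unfolding v_def[abs_def] by (rule lipschitz_on_concat_max[OF w(2)]) (simp add: l_def)
  moreover have "\<exists>s\<in>{0..t}. t - s \<le> h \<and> (v has_vector_derivative H (v s)) (at t)"
    if t: "t \<in> {0..a + h} - insert a N" for t
  proof (cases "t < a")
    case True
    then obtain s where s: "s \<in> {0..t}" "t - s \<le> h" "(w has_vector_derivative H (w s)) (at t)"
      using w(4)[of t] t by auto
    have "(v has_vector_derivative H (w s)) (at t)"
      by (rule has_vector_derivative_transform_within_open[OF s(3), of "{..<a}"]) (use True in \<open>auto simp: v_def\<close>)
    then show ?thesis using s True by (intro bexI[of _ s]) (auto simp: v_def)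
  next
    case False
    then have ta: "t > a" using t by auto
    have "(l has_vector_derivative H (w a)) (at t)"
      unfolding l_def[abs_def] by (auto intro!: derivative_eq_intros)
    then have "(v has_vector_derivative H (w a)) (at t)"
      by (rule has_vector_derivative_transform_within_open[of _ _ _ "{a<..}"]) (use ta in \<open>auto simp: v_def\<close>)
    then show ?thesis using ta t a by (intro bexI[of _ a]) (auto simp: v_def)
  qed
  moreover have "v 0 = w0" using a w(1) by (simp add: v_def)
  ultimately show ?case unfolding a(2) using w(3)
    by (intro exI[of _ v] exI[of _ "max L (norm (H (w a)))"] exI[of _ "insert a N"]) blast
qed

lemma uniform_limit_lipschitz:
  fixes w :: "nat \<Rightarrow> real \<Rightarrow> 'a::metric_space"
  assumes lip: "\<And>k. M-lipschitz_on S (w k)"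
    and lim: "\<And>t. t \<in> S \<Longrightarrow> (\<lambda>k. w k t) \<longlonglongrightarrow> v t"
  shows "M-lipschitz_on S v"
proof (rule lipschitz_onI)
  show "M \<ge> 0" using lip[of 0] by (rule lipschitz_on_nonneg)
  fix s t assume st: "s \<in> S" "t \<in> S"
  have "(\<lambda>k. dist (w k s) (w k t)) \<longlonglongrightarrow> dist (v s) (v t)"
    using lim st by (intro tendsto_dist)
  then show "dist (v s) (v t) \<le> M * dist s t"
    by (rule Lim_bounded[where M = 0]) (use lipschitz_onD[OF lip] st in auto)
qed

section \<open>Velocities of limits of approximate trajectories\<close>

locale control_system =
  fixes D :: "'b::euclidean_space set" and U :: "'c::euclidean_space set"
    and F :: "'b \<times> 'c \<Rightarrow> 'b" and c :: real
  assumes open_D: "open D" and compact_U: "compact U" and U_nonempty: "U \<noteq> {}"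
    and F_cont: "continuous_on (D \<times> U) F" and c_pos: "c > 0"
    and growth: "\<And>w u. w \<in> D \<Longrightarrow> u \<in> U \<Longrightarrow> norm (F (w, u)) \<le> c * (1 + norm w)"
    and convex_F: "\<And>w. w \<in> D \<Longrightarrow> convex ((\<lambda>u. F (w, u)) ` U)"
begin

text \<open>Staying in \<open>D\<close> is not part of the notion, since invariance is applied to
  curves whose endpoint is not yet known to lie in \<open>D\<close>.\<close>

definition trajectory :: "real \<Rightarrow> (real \<Rightarrow> 'c) \<Rightarrow> (real \<Rightarrow> 'b) \<Rightarrow> bool" where
  "trajectory T u w \<longleftrightarrow> u \<in> borel_measurable (lebesgue_on {0..T}) \<and> (\<forall>t\<in>{0..T}. u t \<in> U) \<and>
     abs_continuous_on 0 T w \<and>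
     (AE t in lebesgue_on {0..T}. (w has_vector_derivative F (w t, u t)) (at t within {0..T}))"

lemma velocities_compact:
  assumes "w \<in> D"
  shows "compact ((\<lambda>u. F (w, u)) ` U)"
proof (rule compact_continuous_image[OF _ compact_U])
  show "continuous_on U (\<lambda>u. F (w, u))"
    by (rule continuous_on_compose2[OF F_cont]) (use assms in \<open>auto intro!: continuous_intros\<close>)
qed

text \<open>Upper semicontinuity tested on one half space. Otherwise points tending to
  \<open>w\<close> would carry controls violating the inequality; compactness of \<open>U\<close>
  gives a limit control, and continuity of \<open>F\<close> a violation at \<open>w\<close>.\<close>

lemma velocities_upper_semicontinuous:
  assumes w: "w \<in> D" and less: "\<And>u. u \<in> U \<Longrightarrow> \<beta> < \<alpha> \<bullet> F (w, u)"
  shows "\<exists>\<delta>>0. \<forall>p. dist p w < \<delta> \<longrightarrow> p \<in> D \<and> (\<forall>u\<in>U. \<beta> < \<alpha> \<bullet> F (p, u))"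
proof (rule ccontr)
  assume neg: "\<not> ?thesis"
  obtain r where r: "r > 0" "ball w r \<subseteq> D" using open_D w openE by blast
  have "\<exists>p u. dist p w < min r (1 / real (Suc n)) \<and> u \<in> U \<and> \<alpha> \<bullet> F (p, u) \<le> \<beta>" for n
  proof -
    have "min r (1 / real (Suc n)) > 0" using r by simp
    then obtain p where p: "dist p w < min r (1 / real (Suc n))" "\<not> (p \<in> D \<and> (\<forall>u\<in>U. \<beta> < \<alpha> \<bullet> F (p, u)))"
      using neg by blast
    moreover have "p \<in> D" using p(1) r by (auto simp: dist_commute)
    ultimately show ?thesis by (auto simp: not_less)
  qed
  then obtain p u where pu: "\<And>n. dist (p n) w < min r (1 / real (Suc n))" "\<And>n. u n \<in> U"
    "\<And>n. \<alpha> \<bullet> F (p n, u n) \<le> \<beta>" by metis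
  have pD: "p n \<in> D" for n using pu(1)[of n] r by (auto simp: dist_commute)
  obtain v s where v: "v \<in> U" "strict_mono s" "(u \<circ> s) \<longlonglongrightarrow> v"
    using compact_U pu(2) unfolding compact_def by metis
  have "dist (p n) w \<le> dist (1 / real (Suc n)) 0" for n
    using pu(1)[of n] by (simp add: dist_real_def)
  then have "p \<longlonglongrightarrow> w"
    by (intro metric_tendsto_imp_tendsto[OF LIMSEQ_Suc[OF lim_1_over_n]] always_eventually allI)
  then have "(\<lambda>n. p (s n)) \<longlonglongrightarrow> w" using LIMSEQ_subseq_LIMSEQ[OF _ v(2)] by (simp add: o_def)
  then have "(\<lambda>n. (p (s n), u (s n))) \<longlonglongrightarrow> (w, v)" using v(3) by (intro tendsto_Pair) (simp_all add: o_def)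
  then have "(\<lambda>n. F (p (s n), u (s n))) \<longlonglongrightarrow> F (w, v)"
    by (rule continuous_on_tendsto_compose[OF F_cont]) (use w v pD pu in auto)
  then have "(\<lambda>n. \<alpha> \<bullet> F (p (s n), u (s n))) \<longlonglongrightarrow> \<alpha> \<bullet> F (w, v)" by (intro tendsto_intros)
  then have "\<alpha> \<bullet> F (w, v) \<le> \<beta>" by (rule LIMSEQ_le_const2) (use pu(3) in auto)
  then show False using less[OF v(1)] by simp
qed

text \<open>Near \<open>v t\<close> all admissible velocities lie in any given half space containing those at \<open>v t\<close>;
  by the mean value theorem so do the difference quotients of the approximating curves.\<close>

lemma limit_inclusion:
  assumes lip: "\<And>k. M-lipschitz_on {0..T} (w k)"
    and unif: "\<And>e. e > 0 \<Longrightarrow> \<exists>n. \<forall>k\<ge>n. \<forall>t\<in>{0..T}. dist (w k t) (v t) < e"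
    and N: "\<And>k. negligible (N k)" and \<epsilon>: "\<epsilon> \<longlonglongrightarrow> 0"
    and der: "\<And>k t. t \<in> {0..T} - N k \<Longrightarrow> \<exists>d s. s \<in> {0..t} \<and> t - s \<le> \<epsilon> k \<and>
      (w k has_vector_derivative d) (at t within {0..T}) \<and> (w k s \<in> D \<longrightarrow> d \<in> (\<lambda>u. F (w k s, u)) ` U)"
    and t: "0 \<le> t" "t < T" and vD: "v t \<in> D"
    and e: "(v has_vector_derivative e) (at t within {0..T})"
  shows "e \<in> (\<lambda>u. F (v t, u)) ` U"
proof (rule ccontr)
  assume "\<not> ?thesis"
  then obtain \<alpha> \<beta> where \<alpha>: "\<alpha> \<bullet> e < \<beta>" "\<And>u. u \<in> U \<Longrightarrow> \<beta> < \<alpha> \<bullet> F (v t, u)"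
    using separating_hyperplane_closed_point[OF convex_F[OF vD] compact_imp_closed[OF velocities_compact[OF vD]]]
    by blast
  obtain \<delta> where \<delta>: "\<delta> > 0" "\<And>p. dist p (v t) < \<delta> \<Longrightarrow> p \<in> D \<and> (\<forall>u\<in>U. \<beta> < \<alpha> \<bullet> F (p, u))"
    using velocities_upper_semicontinuous[OF vD \<alpha>(2)] by blast
  have lim: "(\<lambda>k. w k s) \<longlonglongrightarrow> v s" if "s \<in> {0..T}" for s
    unfolding lim_sequentially using unif that by blast
  have vlip: "M-lipschitz_on {0..T} v" by (rule uniform_limit_lipschitz[OF lip lim])
  have M: "M \<ge> 0" using vlip by (rule lipschitz_on_nonneg)
  \<comment> \<open>The distance from \<open>w k y\<close> to \<open>v t\<close> is split at
    \<open>w k x\<close> and \<open>v x\<close>. The delay and the time distance each cost at most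
    \<open>M * r\<close>, the uniform approximation \<open>\<delta> / 3\<close>;
    \<open>M + 1\<close> avoids division by zero.\<close>
  define r where "r = \<delta> / 3 / (M + 1)"
  have "3 * M + 3 \<noteq> 0" using M by linarith
  then have r: "r > 0" "(M + 1) * r = \<delta> / 3" using \<delta> M by (simp_all add: r_def field_simps)
  have quot: "\<beta> \<le> \<alpha> \<bullet> ((v s - v t) /\<^sub>R (s - t))" if s: "t < s" "s \<le> T" "s - t < r" for s
  proof -
    obtain n1 where n1: "\<And>k x. k \<ge> n1 \<Longrightarrow> x \<in> {0..T} \<Longrightarrow> dist (w k x) (v x) < \<delta> / 3"
    proof -
      have "\<delta> / 3 > 0" using \<delta> by simp
      then show ?thesis using unif that by blast
    qed
    have "eventually (\<lambda>k. \<epsilon> k < r) sequentially" using \<epsilon> r by (intro order_tendstoD(2))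
    then obtain n2 where n2: "\<And>k. k \<ge> n2 \<Longrightarrow> \<epsilon> k < r" by (auto simp: eventually_sequentially)
    have C: "(w k s - w k t) /\<^sub>R (s - t) \<in> {x. \<beta> \<le> \<alpha> \<bullet> x}" if k: "k \<ge> max n1 n2" for k
    proof (rule mean_value_closed_convex[OF s(1) _ N[of k]])
      show "abs_continuous_on t s (w k)"
        using lipschitz_imp_abs_continuous_on[OF lip[of k]] t s by (auto intro: abs_continuous_on_subinterval)
      show "convex {x. \<beta> \<le> \<alpha> \<bullet> x}" using convex_halfspace_ge[of \<beta> \<alpha>] by simp
      show "closed {x. \<beta> \<le> \<alpha> \<bullet> x}" using closed_halfspace_ge[of \<beta> \<alpha>] by simp
      fix x assume x: "x \<in> {t..s} - N k"
      then have x': "x \<in> {0..T} - N k" using t s by auto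
      obtain d y where d: "y \<in> {0..x}" "x - y \<le> \<epsilon> k" "(w k has_vector_derivative d) (at x within {0..T})"
        "w k y \<in> D \<longrightarrow> d \<in> (\<lambda>u. F (w k y, u)) ` U" using der[OF x'] by blast
      have "dist (w k y) (v t) \<le> dist (w k y) (w k x) + dist (w k x) (v x) + dist (v x) (v t)"
        by metric
      also have "dist (w k y) (w k x) \<le> M * r"
      proof -
        have "dist (w k y) (w k x) \<le> M * dist y x" using lipschitz_onD[OF lip] d(1) x' by auto
        also have "\<dots> \<le> M * r" using M d(1,2) n2[of k] k by (intro mult_left_mono) (auto simp: dist_real_def)
        finally show ?thesis .
      qed
      also have "dist (w k x) (v x) < \<delta> / 3" using n1 k x' by auto
      also have "dist (v x) (v t) \<le> M * r"
      proof -
        have "dist (v x) (v t) \<le> M * dist x t" using lipschitz_onD[OF vlip] t x' by auto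
        also have "\<dots> \<le> M * r" using M x s by (intro mult_left_mono) (auto simp: dist_real_def)
        finally show ?thesis .
      qed
      finally have "dist (w k y) (v t) < M * r + \<delta> / 3 + M * r" by simp
      also have "M * r + \<delta> / 3 + M * r \<le> \<delta>" using r by (simp add: algebra_simps)
      \<comment> \<open>Closeness to \<open>v t\<close> also places \<open>w k y\<close> in
        \<open>D\<close>, which discharges the condition in \<open>d(4)\<close>.\<close>
      finally have "w k y \<in> D" "\<forall>u\<in>U. \<beta> < \<alpha> \<bullet> F (w k y, u)" using \<delta>(2) by blast+
      then have "\<beta> \<le> \<alpha> \<bullet> d" using d(4) by (auto intro: less_imp_le)
      moreover have "(w k has_vector_derivative d) (at x within {t..s})"
        using d(3) by (rule has_vector_derivative_within_subset) (use t s in auto)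
      ultimately show "\<exists>d\<in>{x. \<beta> \<le> \<alpha> \<bullet> x}. (w k has_vector_derivative d) (at x within {t..s})"
        by blast
    qed
    have "(\<lambda>k. \<alpha> \<bullet> ((w k s - w k t) /\<^sub>R (s - t))) \<longlonglongrightarrow> \<alpha> \<bullet> ((v s - v t) /\<^sub>R (s - t))"
      using lim t s by (intro tendsto_intros) auto
    then show ?thesis by (rule LIMSEQ_le_const) (use C in blast)
  qed
  \<comment> \<open>The bound is known for later times only, so the derivative is read as a right
    derivative; this is where \<open>t < T\<close> enters.\<close>
  have "((\<lambda>s. (v s - v t) /\<^sub>R (s - t)) \<longlongrightarrow> e) (at t within {t..T})"
  proof -
    have "(v has_vector_derivative e) (at t within {t..T})"
      using e by (rule has_vector_derivative_within_subset) (use t in auto)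
    from has_vector_derivative_imp_quotient_tendsto[OF this] show ?thesis by (simp add: inverse_eq_divide)
  qed
  then have "((\<lambda>s. \<alpha> \<bullet> ((v s - v t) /\<^sub>R (s - t))) \<longlongrightarrow> \<alpha> \<bullet> e) (at t within {t..T})"
    by (intro tendsto_intros)
  moreover have "eventually (\<lambda>s. \<beta> \<le> \<alpha> \<bullet> ((v s - v t) /\<^sub>R (s - t))) (at t within {t..T})"
    unfolding eventually_at using r quot by (intro exI[of _ r]) (auto simp: dist_real_def)
  moreover have "at t within {t..T} \<noteq> bot" using t by (simp add: at_within_Icc_at_right)
  ultimately have "\<beta> \<le> \<alpha> \<bullet> e" by (intro tendsto_lowerbound)
  then show False using \<alpha>(1) by simp
qed

end

section \<open>Invariance, compactness and existence of trajectories\<close>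

locale invariant_control_system = control_system +
  assumes invariant: "\<And>\<tau> u w. \<tau> > 0 \<Longrightarrow> trajectory \<tau> u w \<Longrightarrow> (\<And>t. t \<in> {0..<\<tau>} \<Longrightarrow> w t \<in> D) \<Longrightarrow> w \<tau> \<in> D"
begin

text \<open>At the first exit time a Filippov control would contradict the invariance of \<open>D\<close>.\<close>

lemma stays_in_domain:
  assumes ac: "abs_continuous_on 0 T v" and v0: "v 0 \<in> D" and N: "negligible N"
    and der: "\<And>t. t \<in> {0..T} - N \<Longrightarrow> v t \<in> D \<Longrightarrow>
      \<exists>u\<in>U. (v has_vector_derivative F (v t, u)) (at t within {0..T})"
    and t: "t \<in> {0..T}"
  shows "v t \<in> D"
proof (rule ccontr)
  assume "v t \<notin> D"
  define X where "X = {s \<in> {0..T}. v s \<in> - D}"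
  have "closed X"
  proof -
    have "closedin (top_of_set {0..T}) ({0..T} \<inter> v -` (- D))"
      by (rule continuous_closedin_preimage[OF abs_continuous_imp_continuous_on[OF ac]])
        (use open_D in auto)
    then have "closed ({0..T} \<inter> v -` (- D))" by (rule closedin_closed_trans) simp
    also have "{0..T} \<inter> v -` (- D) = X" by (auto simp: X_def)
    finally show ?thesis .
  qed
  moreover have "X \<noteq> {}" "bdd_below X" using \<open>v t \<notin> D\<close> t by (auto simp: X_def)
  ultimately have inX: "Inf X \<in> X" by (intro closed_contains_Inf)
  define \<tau> where "\<tau> = Inf X"
  have \<tau>: "\<tau> \<in> {0..T}" "v \<tau> \<notin> D" using inX by (auto simp: X_def \<tau>_def)
  have "\<tau> > 0" using \<tau> v0 by (cases "\<tau> = 0") auto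
  have before: "v s \<in> D" if "s \<in> {0..<\<tau>}" for s
  proof (rule ccontr)
    assume "v s \<notin> D"
    then have "s \<in> X" using that \<tau> by (auto simp: X_def)
    then have "\<tau> \<le> s" unfolding \<tau>_def using \<open>bdd_below X\<close> by (rule cInf_lower)
    then show False using that by simp
  qed
  have ac\<tau>: "abs_continuous_on 0 \<tau> v" by (rule abs_continuous_on_subinterval[OF ac]) (use \<tau> in auto)
  obtain u where "u \<in> borel_measurable (lebesgue_on {0..\<tau>})" "\<And>t. t \<in> {0..\<tau>} \<Longrightarrow> u t \<in> U"
    "AE t in lebesgue_on {0..\<tau>}. (v has_vector_derivative F (v t, u t)) (at t within {0..\<tau>})"
  proof (rule filippov_selection[OF F_cont compact_U U_nonempty abs_continuous_imp_continuous_on[OF ac\<tau>]])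
    \<comment> \<open>At \<open>\<tau>\<close> the curve is outside \<open>D\<close>, so no velocity
      inclusion is available there; a single time can be discarded.\<close>
    show "negligible (N \<union> {\<tau>})" using N by simp
    fix s assume "s \<in> {0..\<tau>} - (N \<union> {\<tau>})"
    then have s: "s \<in> {0..T} - N" "v s \<in> D" using before[of s] \<tau> by auto
    then obtain u where u: "u \<in> U" "(v has_vector_derivative F (v s, u)) (at s within {0..T})"
      using der by blast
    have "(v has_vector_derivative F (v s, u)) (at s within {0..\<tau>})"
      using u(2) by (rule has_vector_derivative_within_subset) (use \<tau> in auto)
    then show "v s \<in> D \<and> (\<exists>u\<in>U. (v has_vector_derivative F (v s, u)) (at s within {0..\<tau>}))"
      using s u by blast
  qed blast
  then have "trajectory \<tau> u v" using ac\<tau> by (simp add: trajectory_def)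
  then have "v \<tau> \<in> D" using invariant \<open>\<tau> > 0\<close> before by blast
  then show False using \<tau> by simp
qed

lemma trajectory_of_inclusion:
  assumes ac: "abs_continuous_on 0 T v" and N: "negligible N"
    and der: "\<And>t. t \<in> {0..T} - N \<Longrightarrow>
      v t \<in> D \<and> (\<exists>u\<in>U. (v has_vector_derivative F (v t, u)) (at t within {0..T}))"
  shows "\<exists>u. trajectory T u v"
proof -
  obtain u where "u \<in> borel_measurable (lebesgue_on {0..T})" "\<And>t. t \<in> {0..T} \<Longrightarrow> u t \<in> U"
    "AE t in lebesgue_on {0..T}. (v has_vector_derivative F (v t, u t)) (at t within {0..T})"
    using filippov_selection[OF F_cont compact_U U_nonempty abs_continuous_imp_continuous_on[OF ac] N der]
    by blast
  then show ?thesis using ac unfolding trajectory_def by blast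
qed

text \<open>A continuous curve on a compact interval is bounded, so the growth condition bounds its
  velocity. The Lipschitz constant is what makes the running maximum differentiable almost
  everywhere.\<close>

lemma trajectory_lipschitz:
  assumes traj: "trajectory T u w" and wD: "\<And>t. t \<in> {0..T} \<Longrightarrow> w t \<in> D"
  shows "\<exists>L. L-lipschitz_on {0..T} w"
proof -
  have ac: "abs_continuous_on 0 T w" and u: "\<And>t. t \<in> {0..T} \<Longrightarrow> u t \<in> U"
    using traj by (simp_all add: trajectory_def)
  obtain N where N: "negligible N"
    "\<And>t. t \<in> {0..T} - N \<Longrightarrow> (w has_vector_derivative F (w t, u t)) (at t within {0..T})"
    using traj unfolding trajectory_def by (auto simp: AE_lebesgue_on_negligible_iff)
  have "bounded (w ` {0..T})"
    using compact_continuous_image[OF abs_continuous_imp_continuous_on[OF ac]] by (simp add: compact_imp_bounded)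
  then obtain R where R: "R > 0" "\<And>t. t \<in> {0..T} \<Longrightarrow> norm (w t) \<le> R"
    unfolding bounded_pos by blast
  have "(c * (1 + R))-lipschitz_on {0..T} w"
  proof (rule bounded_derivative_imp_lipschitz[OF ac N(1)])
    fix t assume t: "t \<in> {0..T} - N"
    have "norm (F (w t, u t)) \<le> c * (1 + norm (w t))" using growth wD u t by simp
    also have "\<dots> \<le> c * (1 + R)" using R t c_pos by (intro mult_left_mono) auto
    finally show "\<exists>d. norm d \<le> c * (1 + R) \<and> (w has_vector_derivative d) (at t within {0..T})"
      using N(2)[OF t] by blast
  qed (use R c_pos in simp)
  then show ?thesis by blast
qed

text \<open>One form for Euler polygons, with delay \<open>\<epsilon> k\<close>, and for exact
  trajectories, with delay 0. The growth bound is demanded everywhere, to give a uniform Lipschitz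
  constant, but the inclusion only at points of \<open>D\<close>.\<close>

lemma compactness_of_approximate_trajectories:
  assumes T: "T > 0" and w0: "w0 \<in> D" "\<And>k. w k 0 = w0" and ac: "\<And>k. abs_continuous_on 0 T (w k)"
    and N: "\<And>k. negligible (N k)" and \<epsilon>: "\<epsilon> \<longlonglongrightarrow> 0"
    and der: "\<And>k t. t \<in> {0..T} - N k \<Longrightarrow> \<exists>d s. s \<in> {0..t} \<and> t - s \<le> \<epsilon> k \<and>
      (w k has_vector_derivative d) (at t within {0..T}) \<and> norm d \<le> c * (1 + norm (w k s)) \<and>
      (w k s \<in> D \<longrightarrow> d \<in> (\<lambda>u. F (w k s, u)) ` U)"
  obtains v u r where "trajectory T u v" "v 0 = w0" "\<And>t. t \<in> {0..T} \<Longrightarrow> v t \<in> D" "strict_mono (r :: nat \<Rightarrow> nat)"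
    "\<And>e. e > 0 \<Longrightarrow> \<exists>n. \<forall>k\<ge>n. \<forall>t\<in>{0..T}. dist (w (r k) t) (v t) < e"
proof -
  \<comment> \<open>Enough doubling intervals of length \<open>1 / (2 * c)\<close> to cover
    \<open>{0..T}\<close>.\<close>
  define n where "n = nat \<lceil>2 * c * T\<rceil>"
  have n: "T \<le> real n / (2 * c)"
  proof -
    have "2 * c * T \<le> real n" unfolding n_def by linarith
    then show ?thesis using c_pos by (simp add: field_simps)
  qed
  define R where "R = 2 ^ n * (1 + norm w0)"
  have bound: "1 + norm (w k t) \<le> R" if t: "t \<in> {0..T}" for k t
  proof -
    have "1 + norm (w k t) \<le> 2 ^ n * (1 + norm (w k 0))"
    proof (rule linear_growth_bound[OF ac N c_pos _ t])
      fix s assume "s \<in> {0..T} - N k"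
      from der[OF this] show "\<exists>d sa. sa \<in> {0..s} \<and> norm d \<le> c * (1 + norm (w k sa)) \<and>
          (w k has_vector_derivative d) (at s within {0..T})" by blast
    qed (use t n in auto)
    then show ?thesis by (simp add: R_def w0)
  qed
  have R: "R \<ge> 0" unfolding R_def by simp
  have lip: "(c * R)-lipschitz_on {0..T} (w k)" for k
  proof (rule bounded_derivative_imp_lipschitz[OF ac N])
    fix t assume t: "t \<in> {0..T} - N k"
    obtain d s where d: "s \<in> {0..t}" "(w k has_vector_derivative d) (at t within {0..T})"
      "norm d \<le> c * (1 + norm (w k s))" using der[OF t] by blast
    have "c * (1 + norm (w k s)) \<le> c * R"
      using bound[of s k] d t c_pos by (intro mult_left_mono) auto
    then show "\<exists>d. norm d \<le> c * R \<and> (w k has_vector_derivative d) (at t within {0..T})"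
      using d by (intro exI[of _ d]) auto
  qed (use R c_pos in simp)
  have equi: "\<exists>d>0. \<forall>n s. s \<in> {0..T} \<and> norm (t - s) < d \<longrightarrow> norm (w n t - w n s) < e"
    if t: "t \<in> {0..T}" and e: "0 < e" for t e
  proof -
    have "norm (w k t - w k s) < e" if s: "s \<in> {0..T}" "norm (t - s) < e / (c * R + 1)" for k s
    proof -
      have p: "c * R \<ge> 0" using R c_pos by simp
      have "norm (w k t - w k s) \<le> c * R * norm (t - s)"
        using lipschitz_onD[OF lip t s(1)] by (simp add: dist_norm)
      also have "\<dots> \<le> (c * R + 1) * norm (t - s)" by (intro mult_right_mono) auto
      also have "\<dots> < (c * R + 1) * (e / (c * R + 1))" using s p by (intro mult_strict_left_mono) auto
      also have "\<dots> = e" using p by simp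
      finally show ?thesis .
    qed
    moreover have "e / (c * R + 1) > 0" using e R c_pos by (simp add: add_nonneg_pos)
    ultimately show ?thesis by blast
  qed
  have le_R: "norm (w k t) \<le> R" if "t \<in> {0..T}" for k t using bound[OF that, of k] by simp
  obtain v and r :: "nat \<Rightarrow> nat" where "continuous_on {0..T} v" and v: "strict_mono r"
    "\<And>e. 0 < e \<Longrightarrow> \<exists>N. \<forall>n x. n \<ge> N \<and> x \<in> {0..T} \<longrightarrow> norm (w (r n) x - v x) < e"
  proof (rule Arzela_Ascoli[OF compact_Icc le_R equi])
    fix v and r :: "nat \<Rightarrow> nat"
    assume *: "continuous_on {0..T} v" "strict_mono r"
      "\<And>e. 0 < e \<Longrightarrow> \<exists>N. \<forall>n x. n \<ge> N \<and> x \<in> {0..T} \<longrightarrow> norm (w (r n) x - v x) < e"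
    show thesis by (rule that[OF *(1) *(2) *(3)])
  qed auto
  have unif: "\<exists>n. \<forall>k\<ge>n. \<forall>t\<in>{0..T}. dist (w (r k) t) (v t) < e" if "e > 0" for e
    using v(2)[OF that] unfolding dist_norm by blast
  have lim: "(\<lambda>k. w (r k) t) \<longlonglongrightarrow> v t" if "t \<in> {0..T}" for t
    unfolding lim_sequentially using unif that by blast
  have vlip: "(c * R)-lipschitz_on {0..T} v" by (rule uniform_limit_lipschitz[OF lip lim])
  have vac: "abs_continuous_on 0 T v" using vlip by (rule lipschitz_imp_abs_continuous_on)
  have v0: "v 0 = w0"
    using lim[of 0] w0 T LIMSEQ_unique[of "\<lambda>_. w0" "v 0" w0] by simp
  obtain N0 where N0: "negligible N0" "\<And>t. t \<in> {0..T} - N0 \<Longrightarrow> \<exists>d. (v has_vector_derivative d) (at t within {0..T})"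
    using lipschitz_differentiable_ae[OF vlip] T by (meson less_imp_le)
  have incl: "\<exists>u\<in>U. (v has_vector_derivative F (v t, u)) (at t within {0..T})"
    if t: "t \<in> {0..T} - insert T N0" and vD: "v t \<in> D" for t
  proof -
    obtain e where e: "(v has_vector_derivative e) (at t within {0..T})" using N0(2)[of t] t by auto
    have "e \<in> (\<lambda>u. F (v t, u)) ` U"
    proof (rule limit_inclusion[of "c * R" T "\<lambda>k. w (r k)" v "\<lambda>k. N (r k)" "\<lambda>k. \<epsilon> (r k)"])
      show "(\<lambda>k. \<epsilon> (r k)) \<longlonglongrightarrow> 0" using LIMSEQ_subseq_LIMSEQ[OF \<epsilon> v(1)] by (simp add: o_def)
      show "\<exists>d s. s \<in> {0..x} \<and> x - s \<le> \<epsilon> (r k) \<and> (w (r k) has_vector_derivative d) (at x within {0..T}) \<and>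
          (w (r k) s \<in> D \<longrightarrow> d \<in> (\<lambda>u. F (w (r k) s, u)) ` U)" if "x \<in> {0..T} - N (r k)" for k x
        using der[OF that] by blast
    qed (use lip unif N t vD e in auto)
    then show ?thesis using e by blast
  qed
  have N0': "negligible (insert T N0)" using N0 by simp
  \<comment> \<open>\<open>incl\<close> is conditional on \<open>v t \<in> D\<close>, exactly the
    form from which the first exit argument excludes an exit.\<close>
  have vD: "v t \<in> D" if "t \<in> {0..T}" for t
    using stays_in_domain[OF vac _ N0' incl that] w0 v0 by blast
  obtain u where "trajectory T u v"
    using trajectory_of_inclusion[OF vac N0'] incl vD by blast
  then show ?thesis using that v0 vD v(1) unif by blast
qed

text \<open>Polygons are built for one constant control, but the limit is only known to solve the
  inclusion; its control comes from selection and need not be that constant.\<close>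

lemma trajectory_exists:
  assumes T: "T > 0" and w0: "w0 \<in> D"
  obtains u w where "trajectory T u w" "w 0 = w0" "\<And>t. t \<in> {0..T} \<Longrightarrow> w t \<in> D"
proof -
  obtain u0 where u0: "u0 \<in> U" using U_nonempty by blast
  \<comment> \<open>Extension by zero keeps the growth bound valid when a polygon leaves
    \<open>D\<close>.\<close>
  define H where "H w = (if w \<in> D then F (w, u0) else 0)" for w
  define h where "h k = T / real (Suc k)" for k
  have "\<forall>k. \<exists>w L N. w 0 = w0 \<and> L-lipschitz_on {0..T} w \<and> finite N \<and>
    (\<forall>t\<in>{0..T} - N. \<exists>s\<in>{0..t}. t - s \<le> h k \<and> (w has_vector_derivative H (w s)) (at t))"
  proof
    fix k
    have "h k > 0" "real (Suc k) * h k = T" using T by (simp_all add: h_def)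
    then show "\<exists>w L N. w 0 = w0 \<and> L-lipschitz_on {0..T} w \<and> finite N \<and>
      (\<forall>t\<in>{0..T} - N. \<exists>s\<in>{0..t}. t - s \<le> h k \<and> (w has_vector_derivative H (w s)) (at t))"
      using euler_polygon[of "h k" w0 "Suc k" H] by simp
  qed
  then obtain w L N where w: "\<And>k. w k 0 = w0" "\<And>k. (L k)-lipschitz_on {0..T} (w k)" "\<And>k. finite (N k)"
    "\<And>k t. t \<in> {0..T} - N k \<Longrightarrow> \<exists>s\<in>{0..t}. t - s \<le> h k \<and> (w k has_vector_derivative H (w k s)) (at t)"
    by metis
  show ?thesis
  proof (rule compactness_of_approximate_trajectories[where w = w and N = N and \<epsilon> = h, OF T w0 w(1)])
    show "abs_continuous_on 0 T (w k)" for k using w(2) by (rule lipschitz_imp_abs_continuous_on)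
    show "negligible (N k)" for k using w(3) by (rule negligible_finite)
    show "h \<longlonglongrightarrow> 0" unfolding h_def using tendsto_mult_right_zero[OF LIMSEQ_Suc[OF lim_1_over_n], of T] by simp
    fix k t assume t: "t \<in> {0..T} - N k"
    obtain s where s: "s \<in> {0..t}" "t - s \<le> h k" "(w k has_vector_derivative H (w k s)) (at t)"
      using w(4)[OF t] by blast
    have "norm (H (w k s)) \<le> c * (1 + norm (w k s))"
      using growth u0 c_pos by (auto simp: H_def)
    moreover have "w k s \<in> D \<longrightarrow> H (w k s) \<in> (\<lambda>u. F (w k s, u)) ` U" using u0 by (simp add: H_def)
    ultimately show "\<exists>d s. s \<in> {0..t} \<and> t - s \<le> h k \<and> (w k has_vector_derivative d) (at t within {0..T}) \<and>
        norm d \<le> c * (1 + norm (w k s)) \<and> (w k s \<in> D \<longrightarrow> d \<in> (\<lambda>u. F (w k s, u)) ` U)"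
      using s has_vector_derivative_at_within by blast
  qed (use that in blast)
qed

lemma trajectory_limit:
  assumes T: "T > 0" and w0: "w0 \<in> D" "\<And>k. w k 0 = w0"
    and traj: "\<And>k. trajectory T (u k) (w k)" and wD: "\<And>k t. t \<in> {0..T} \<Longrightarrow> w k t \<in> D"
  obtains v u' r where "trajectory T u' v" "v 0 = w0" "\<And>t. t \<in> {0..T} \<Longrightarrow> v t \<in> D" "strict_mono (r :: nat \<Rightarrow> nat)"
    "\<And>e. e > 0 \<Longrightarrow> \<exists>n. \<forall>k\<ge>n. \<forall>t\<in>{0..T}. dist (w (r k) t) (v t) < e"
proof -
  have "\<forall>k. \<exists>N. negligible N \<and> (\<forall>t\<in>{0..T} - N. (w k has_vector_derivative F (w k t, u k t)) (at t within {0..T}))"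
    using traj unfolding trajectory_def by (simp add: AE_lebesgue_on_negligible_iff)
  then obtain N where N: "\<And>k. negligible (N k)"
    "\<And>k t. t \<in> {0..T} - N k \<Longrightarrow> (w k has_vector_derivative F (w k t, u k t)) (at t within {0..T})" by metis
  show ?thesis
  proof (rule compactness_of_approximate_trajectories[where w = w and N = N and \<epsilon> = "\<lambda>_. 0", OF T w0])
    show "abs_continuous_on 0 T (w k)" for k using traj by (simp add: trajectory_def)
    fix k t assume t: "t \<in> {0..T} - N k"
    have u: "u k t \<in> U" using traj t by (simp add: trajectory_def)
    have "norm (F (w k t, u k t)) \<le> c * (1 + norm (w k t))" using growth u wD t by simp
    then show "\<exists>d s. s \<in> {0..t} \<and> t - s \<le> 0 \<and> (w k has_vector_derivative d) (at t within {0..T}) \<and>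
        norm d \<le> c * (1 + norm (w k s)) \<and> (w k s \<in> D \<longrightarrow> d \<in> (\<lambda>u. F (w k s, u)) ` U)"
      using N(2)[OF t] u t by (intro exI[of _ "F (w k t, u k t)"] exI[of _ t]) auto
  qed (use that N(1) in auto)
qed

end

section \<open>The running maximum\<close>

lemma max_over_upper:
  assumes "continuous_on {0..T} y" "t \<in> {0..T}"
  shows "y t \<le> max_over T y"
  unfolding max_over_def
proof (rule cSUP_upper[OF assms(2)])
  show "bdd_above (y ` {0..T})"
    using compact_continuous_image[OF assms(1)] by (simp add: compact_imp_bounded bounded_imp_bdd_above)
qed

lemma max_over_least:
  assumes "0 \<le> T" "\<And>t. t \<in> {0..T} \<Longrightarrow> y t \<le> a"
  shows "max_over T y \<le> a"
  unfolding max_over_def by (rule cSUP_least) (use assms in auto)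

text \<open>Between \<open>s\<close> and \<open>t\<close> the function exceeds \<open>y s\<close> by
  at most \<open>M * (t - s)\<close>, and so does the running maximum its value at
  \<open>s\<close>.\<close>

lemma max_over_lipschitz:
  assumes y: "M-lipschitz_on {0..T} y"
  shows "M-lipschitz_on {0..T} (\<lambda>t. max_over t y)"
    and "\<And>s t. 0 \<le> s \<Longrightarrow> s \<le> t \<Longrightarrow> t \<le> T \<Longrightarrow> max_over s y \<le> max_over t y"
proof -
  have M: "M \<ge> 0" using y by (rule lipschitz_on_nonneg)
  have c: "continuous_on {0..t} y" if "t \<le> T" for t
    using lipschitz_on_continuous_on[OF y] by (rule continuous_on_subset) (use that in auto)
  show mono: "max_over s y \<le> max_over t y" if "0 \<le> s" "s \<le> t" "t \<le> T" for s t
    by (rule max_over_least) (use that c max_over_upper[OF c, of t] in auto)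
  have up: "max_over t y \<le> max_over s y + M * (t - s)" if st: "0 \<le> s" "s \<le> t" "t \<le> T" for s t
  proof (rule max_over_least)
    fix r assume r: "r \<in> {0..t}"
    show "y r \<le> max_over s y + M * (t - s)"
    proof (cases "r \<le> s")
      case True
      then have "y r \<le> max_over s y" using max_over_upper[OF c, of s r] st r by simp
      moreover have "0 \<le> M * (t - s)" using M st by simp
      ultimately show ?thesis by linarith
    next
      case False
      have "y r \<le> y s + M * (r - s)"
        using lipschitz_onD[OF y, of r s] st r False by (simp add: dist_real_def)
      also have "y s \<le> max_over s y" using max_over_upper[OF c, of s s] st by simp
      also have "M * (r - s) \<le> M * (t - s)" using M r by (intro mult_left_mono) auto
      finally show ?thesis by simp
    qed
  qed (use st in simp)
  show "M-lipschitz_on {0..T} (\<lambda>t. max_over t y)"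
  proof (rule lipschitz_on_leI[OF _ M])
    fix s t assume "s \<in> {0..T}" "t \<in> {0..T}" "s \<le> t"
    then show "dist (max_over s y) (max_over t y) \<le> M * dist s t"
      using up[of s t] mono[of s t] by (simp add: dist_real_def)
  qed
qed

text \<open>Where \<open>max_over t y > y t\<close> the running maximum is locally constant; where the two agree,
  \<open>max_over t y - y t\<close> has a local minimum.\<close>

lemma max_over_derivative:
  assumes y: "M-lipschitz_on {0..T} y" and t: "0 < t" "t < T"
    and dz: "((\<lambda>t. max_over t y) has_real_derivative e) (at t)"
    and dy: "(y has_real_derivative d) (at t)"
  shows "if max_over t y = y t then e = max d 0 else e = 0"
proof -
  define z where "z t = max_over t y" for t
  have cy: "continuous_on {0..s} y" if "s \<le> T" for s
    using lipschitz_on_continuous_on[OF y] by (rule continuous_on_subset) (use that in auto)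
  have mono: "z s \<le> z r" if "0 \<le> s" "s \<le> r" "r \<le> T" for s r
    unfolding z_def using max_over_lipschitz(2)[OF y that] .
  have zy: "y s \<le> z s" if "s \<in> {0..T}" for s
    unfolding z_def using max_over_upper[OF cy, of s s] that by simp
  have dz': "(z has_real_derivative e) (at t)" using dz unfolding z_def[abs_def] .
  have e0: "e \<ge> 0"
  proof (rule ccontr)
    assume "\<not> ?thesis"
    then obtain \<delta> where \<delta>: "\<delta> > 0" "\<And>h. 0 < h \<Longrightarrow> h < \<delta> \<Longrightarrow> z (t + h) < z t"
      using DERIV_neg_dec_right[OF dz'] by auto
    define h where "h = min (\<delta> / 2) (T - t)"
    have "0 < h" "h < \<delta>" "h \<le> T - t" using \<delta> t by (auto simp: h_def)
    then show False using \<delta>(2)[of h] mono[of t "t + h"] t by auto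
  qed
  show ?thesis
  proof (cases "z t = y t")
    case True
    \<comment> \<open>The nonnegative function \<open>z - y\<close> vanishes at \<open>t\<close>, so
      its derivative is 0 and \<open>e = d\<close>; together with \<open>e0\<close> this gives
      \<open>e = max d 0\<close>.\<close>
    have "((\<lambda>s. z s - y s) has_real_derivative (e - d)) (at t)" by (rule DERIV_diff[OF dz' dy])
    then have "e - d = 0"
    proof (rule DERIV_local_min)
      show "0 < min t (T - t)" using t by simp
      show "\<forall>s. \<bar>t - s\<bar> < min t (T - t) \<longrightarrow> z t - y t \<le> z s - y s"
        using zy True by (auto simp: abs_if split: if_splits)
    qed
    then show ?thesis using e0 True by (simp add: z_def)
  next
    case False
    then have less: "y t < z t" using zy[of t] t by auto
    have "(y \<longlongrightarrow> y t) (at t)" using DERIV_isCont[OF dy] by (simp add: isCont_def)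
    then have "eventually (\<lambda>s. y s < z t) (at t)" using less by (rule order_tendstoD(2))
    then obtain \<delta> where \<delta>: "\<delta> > 0" "\<And>s. s \<noteq> t \<Longrightarrow> dist s t < \<delta> \<Longrightarrow> y s < z t"
      by (auto simp: eventually_at)
    have "e = 0"
    proof (rule DERIV_local_max[OF dz'])
      show "0 < min \<delta> (min t (T - t))" using t \<delta> by simp
      have "z s \<le> z t" if s: "\<bar>t - s\<bar> < min \<delta> (min t (T - t))" for s
      proof (cases "s \<le> t")
        case True then show ?thesis using mono[of s t] s t by auto
      next
        case False
        show ?thesis unfolding z_def[of s]
        proof (rule max_over_least)
          fix r assume r: "r \<in> {0..s}"
          show "y r \<le> z t"
          proof (cases "r \<le> t")
            case True then show ?thesis using max_over_upper[OF cy, of t r] r t by (simp add: z_def)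
          next
            case False
            then have "dist r t < \<delta>" using r s by (auto simp: dist_real_def)
            then show ?thesis using \<delta>(2)[of r] False by auto
          qed
        qed (use False t in simp)
      qed
      then show "\<forall>s. \<bar>t - s\<bar> < min \<delta> (min t (T - t)) \<longrightarrow> z s \<le> z t" by blast
    qed
    then show ?thesis using False by (simp add: z_def)
  qed
qed

lemma has_vector_derivative_fst:
  assumes "(w has_vector_derivative d) F"
  shows "((\<lambda>t. fst (w t)) has_vector_derivative fst d) F"
  using bounded_linear.has_vector_derivative[OF bounded_linear_fst assms] .

lemma has_vector_derivative_snd:
  assumes "(w has_vector_derivative d) F"
  shows "((\<lambda>t. snd (w t)) has_vector_derivative snd d) F"
  using bounded_linear.has_vector_derivative[OF bounded_linear_snd assms] .

section \<open>The inclusion compared with the control system\<close>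

lemma F_incl_iff:
  "d \<in> F_incl U f g \<xi> \<longleftrightarrow> (\<exists>u\<in>U. \<exists>v\<in>{0..1}. d =
    (f ((fst \<xi>, fst (snd \<xi>)), u), g ((fst \<xi>, fst (snd \<xi>)), u),
     max (g ((fst \<xi>, fst (snd \<xi>)), u)) 0 * (1 - v * indicator {0..} (snd (snd \<xi>) - fst (snd \<xi>)))))"
  unfolding F_incl_def by (cases \<xi>) (simp only: prod.case fst_conv snd_conv, blast)

text \<open>The third component can never fall below the second: on an excursion below it the indicator
  vanishes, so there \<open>z' = max g 0 \<ge> y'\<close>.\<close>

lemma S_l_max_le:
  assumes \<xi>: "\<xi> \<in> S_l D U f g T x0 y0" and T: "T > 0"
  shows "max_over T (\<lambda>t. fst (snd (\<xi> t))) \<le> snd (snd (\<xi> T))"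
proof -
  define y where "y t = fst (snd (\<xi> t))" for t
  define z where "z t = snd (snd (\<xi> t))" for t
  have ac: "abs_continuous_on 0 T \<xi>" and init: "\<xi> 0 = (x0, y0, y0)" using \<xi> by (auto simp: S_l_def)
  obtain N where N: "negligible N" "\<And>t. t \<in> {0..T} - N \<Longrightarrow>
      \<exists>d\<in>F_incl U f g (\<xi> t). (\<xi> has_vector_derivative d) (at t within {0..T})"
    using \<xi> unfolding S_l_def by (auto simp: AE_lebesgue_on_negligible_iff)
  have der: "\<exists>\<gamma> v. v \<in> {0..1} \<and> (y has_vector_derivative \<gamma>) (at t within {0..T}) \<and>
      (z has_vector_derivative (max \<gamma> 0 * (1 - v * indicator {0..} (z t - y t)))) (at t within {0..T})"
    if t: "t \<in> {0..T} - N" for t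
  proof -
    obtain d where d: "d \<in> F_incl U f g (\<xi> t)" "(\<xi> has_vector_derivative d) (at t within {0..T})"
      using N(2)[OF t] by blast
    obtain u v where uv: "v \<in> {0..1}" "fst (snd d) = g ((fst (\<xi> t), y t), u)"
      "snd (snd d) = max (g ((fst (\<xi> t), y t), u)) 0 * (1 - v * indicator {0..} (z t - y t))"
      using d(1) unfolding F_incl_iff y_def z_def by force
    have "(y has_vector_derivative fst (snd d)) (at t within {0..T})"
      "(z has_vector_derivative snd (snd d)) (at t within {0..T})"
      unfolding y_def[abs_def] z_def[abs_def]
      by (intro has_vector_derivative_fst has_vector_derivative_snd d(2))+
    then show ?thesis using uv by (intro exI[of _ "g ((fst (\<xi> t), y t), u)"] exI[of _ v]) simp
  qed
  have acy: "abs_continuous_on 0 T y" and acz: "abs_continuous_on 0 T z"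
    unfolding y_def[abs_def] z_def[abs_def]
    by (rule abs_continuous_on_compare[OF ac, of _ 1],
        simp only: mult_1, rule order_trans[OF dist_fst_le dist_snd_le] order_trans[OF dist_snd_le dist_snd_le])+
  have acyz: "abs_continuous_on 0 T (\<lambda>t. y t - z t)"
  proof (rule abs_continuous_on_compare[OF ac])
    fix s t
    have "dist (y s - z s) (y t - z t) \<le> dist (y s) (y t) + dist (z s) (z t)"
      by (simp add: dist_real_def)
    also have "dist (y s) (y t) \<le> dist (\<xi> s) (\<xi> t)"
      unfolding y_def by (meson dist_fst_le dist_snd_le order_trans)
    also have "dist (z s) (z t) \<le> dist (\<xi> s) (\<xi> t)"
      unfolding z_def by (meson dist_snd_le order_trans)
    finally show "dist (y s - z s) (y t - z t) \<le> 2 * dist (\<xi> s) (\<xi> t)" by simp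
  qed
  have zy: "y t \<le> z t" if t: "t \<in> {0..T}" for t
  proof (rule ccontr)
    assume neg: "\<not> ?thesis"
    \<comment> \<open>Its supremum \<open>a\<close> is the last time up to \<open>t\<close> with
      \<open>y <= z\<close>; the common initial value makes \<open>X\<close> nonempty, and
      \<open>{a<..t}\<close> is the excursion.\<close>
    define X where "X = {s \<in> {0..t}. y s - z s \<in> {..0}}"
    have "continuous_on {0..t} (\<lambda>s. y s - z s)"
      using abs_continuous_imp_continuous_on[OF acyz] by (rule continuous_on_subset) (use t in auto)
    then have "closedin (top_of_set {0..t}) ({0..t} \<inter> (\<lambda>s. y s - z s) -` {..0})"
      by (rule continuous_closedin_preimage) simp
    then have "closed ({0..t} \<inter> (\<lambda>s. y s - z s) -` {..0})" by (rule closedin_closed_trans) simp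
    also have "{0..t} \<inter> (\<lambda>s. y s - z s) -` {..0} = X" by (auto simp: X_def)
    finally have "closed X" .
    moreover have "0 \<in> X" using t init by (simp add: X_def y_def z_def)
    moreover have bdd: "bdd_above X" by (auto simp: X_def)
    ultimately have "Sup X \<in> X" by (intro closed_contains_Sup) auto
    define a where "a = Sup X"
    have a: "0 \<le> a" "a \<le> t" "y a \<le> z a" using \<open>Sup X \<in> X\<close> by (auto simp: X_def a_def)
    have above: "z s < y s" if "a < s" "s \<le> t" for s
    proof (rule ccontr)
      assume "\<not> ?thesis"
      then have "s \<in> X" using that a by (simp add: X_def)
      then have "s \<le> a" unfolding a_def using bdd by (rule cSup_upper)
      then show False using that by simp
    qed
    have "(y t - z t) - (y a - z a) \<le> 0 * (t - a)"
    proof (rule abs_continuous_increment_le[OF a(2)])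
      show "abs_continuous_on a t (\<lambda>s. y s - z s)"
        by (rule abs_continuous_on_subinterval[OF acyz]) (use a t in auto)
      show "negligible (insert a N)" using N by simp
      fix s assume s: "s \<in> {a..t} - insert a N"
      then have "s \<in> {0..T} - N" using a t by auto
      from der[OF this] obtain \<gamma> v where d: "(y has_vector_derivative \<gamma>) (at s within {0..T})"
        "(z has_vector_derivative (max \<gamma> 0 * (1 - v * indicator {0..} (z s - y s)))) (at s within {0..T})"
        by blast
      have "z s < y s" using above[of s] s by simp
      then have "((\<lambda>s. y s - z s) has_vector_derivative (\<gamma> - max \<gamma> 0)) (at s within {0..T})"
        using has_vector_derivative_diff[OF d] by (simp add: indicator_def)
      then have "((\<lambda>s. y s - z s) has_vector_derivative (\<gamma> - max \<gamma> 0)) (at s within {a..t})"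
        by (rule has_vector_derivative_within_subset) (use a t in auto)
      then show "\<exists>d\<le>0. ((\<lambda>s. y s - z s) has_vector_derivative d) (at s within {a..t})"
        by (intro exI[of _ "\<gamma> - max \<gamma> 0"]) auto
    qed
    then show False using a neg by simp
  qed
  have zmono: "z t \<le> z T" if t: "t \<in> {0..T}" for t
  proof -
    \<comment> \<open>The factor multiplying \<open>max \<gamma> 0\<close> lies in
      \<open>{0..1}\<close>, so \<open>z\<close> has nonnegative velocity.\<close>
    have "- z T - - z t \<le> 0 * (T - t)"
    proof (rule abs_continuous_increment_le)
      show "abs_continuous_on t T (\<lambda>s. - z s)"
      proof (rule abs_continuous_on_compare[where K = 1])
        show "abs_continuous_on t T z" by (rule abs_continuous_on_subinterval[OF acz]) (use t in auto)
      qed (simp add: dist_real_def)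
      fix s assume s: "s \<in> {t..T} - N"
      then have s': "s \<in> {0..T} - N" using t by auto
      obtain \<gamma> v where v: "v \<in> {0..1}"
        "(z has_vector_derivative (max \<gamma> 0 * (1 - v * indicator {0..} (z s - y s)))) (at s within {0..T})"
        using der[OF s'] by blast
      have "0 \<le> max \<gamma> 0 * (1 - v * indicator {0..} (z s - y s))"
        using v(1) by (intro mult_nonneg_nonneg) (auto simp: indicator_def)
      moreover have "((\<lambda>s. - z s) has_vector_derivative - (max \<gamma> 0 * (1 - v * indicator {0..} (z s - y s)))) (at s within {t..T})"
        using has_vector_derivative_within_subset[OF has_vector_derivative_minus[OF v(2)], of "{t..T}"] t by auto
      ultimately show "\<exists>d\<le>0. ((\<lambda>s. - z s) has_vector_derivative d) (at s within {t..T})"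
        by (intro exI[of _ "- (max \<gamma> 0 * (1 - v * indicator {0..} (z s - y s)))"]) auto
    qed (use t N in auto)
    then show ?thesis by simp
  qed
  have "max_over T y \<le> z T"
    by (rule max_over_least) (use T zy zmono in \<open>auto intro: order_trans\<close>)
  then show ?thesis by (simp add: y_def[abs_def] z_def)
qed

lemma C1_on_imp_continuous_on: "C1_on S h \<Longrightarrow> continuous_on S h"
  unfolding C1_on_def continuous_on_eq_continuous_within using has_derivative_continuous by blast

lemma norm_fst_plus_norm_snd_le:
  fixes w :: "'a::real_normed_vector \<times> 'b::real_normed_vector"
  shows "norm (fst w) + norm (snd w) \<le> 2 * norm w"
  using norm_fst_le[where x = "fst w" and y = "snd w"] norm_snd_le[where x = "fst w" and y = "snd w"] by simp

text \<open>The parameter \<open>v\<close> switches the third velocity: at contact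
  \<open>v = 0\<close> lets \<open>z\<close> follow \<open>max g 0\<close>, off contact the
  indicator is 1 and \<open>v = 1\<close> stops \<open>z\<close>. These are the two cases of the
  derivative of the running maximum.\<close>

lemma trajectory_with_running_max_in_S_l:
  assumes adm: "(u, w) \<in> admissible_pairs D U f g T (x0, y0)" and lip: "L-lipschitz_on {0..T} w" and T: "T > 0"
  shows "(\<lambda>t. (fst (w t), snd (w t), max_over t (\<lambda>s. snd (w s)))) \<in> S_l D U f g T x0 y0"
proof -
  define y where "y t = snd (w t)" for t
  define z where "z t = max_over t y" for t
  define \<xi> where "\<xi> t = (fst (w t), y t, z t)" for t
  have w: "w 0 = (x0, y0)" "\<And>t. t \<in> {0..T} \<Longrightarrow> w t \<in> D" "\<And>t. t \<in> {0..T} \<Longrightarrow> u t \<in> U"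
    using adm by (auto simp: admissible_pairs_def controls_def)
  have L: "L \<ge> 0" using lip by (rule lipschitz_on_nonneg)
  have ylip: "L-lipschitz_on {0..T} y"
  proof (rule lipschitz_onI[OF _ L])
    fix s t assume "s \<in> {0..T}" "t \<in> {0..T}"
    then show "dist (y s) (y t) \<le> L * dist s t"
      unfolding y_def using lipschitz_onD[OF lip] dist_snd_le order_trans by blast
  qed
  have zlip: "L-lipschitz_on {0..T} z" unfolding z_def[abs_def] by (rule max_over_lipschitz[OF ylip])
  have "(3 * L)-lipschitz_on {0..T} \<xi>"
  proof (rule lipschitz_onI)
    fix s t assume st: "s \<in> {0..T}" "t \<in> {0..T}"
    have "dist (\<xi> s) (\<xi> t) \<le> dist (fst (w s)) (fst (w t)) + dist (y s, z s) (y t, z t)"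
      unfolding \<xi>_def dist_Pair_Pair[of "fst (w s)"] by (rule sqrt_sum_squares_le_sum) auto
    also have "dist (y s, z s) (y t, z t) \<le> dist (y s) (y t) + dist (z s) (z t)"
      unfolding dist_Pair_Pair by (rule sqrt_sum_squares_le_sum) auto
    also have "dist (fst (w s)) (fst (w t)) \<le> dist (w s) (w t)" by (rule dist_fst_le)
    finally have "dist (\<xi> s) (\<xi> t) \<le> dist (w s) (w t) + (dist (y s) (y t) + dist (z s) (z t))" by simp
    then show "dist (\<xi> s) (\<xi> t) \<le> 3 * L * dist s t"
      using lipschitz_onD[OF lip st] lipschitz_onD[OF ylip st] lipschitz_onD[OF zlip st] by simp
  qed (use L in simp)
  then have ac: "abs_continuous_on 0 T \<xi>" by (rule lipschitz_imp_abs_continuous_on)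
  obtain N where N: "negligible N" "\<And>t. t \<in> {0..T} - N \<Longrightarrow>
      (w has_vector_derivative (f (w t, u t), g (w t, u t))) (at t within {0..T})"
    using adm unfolding admissible_pairs_def satisfies_control_ode_def
    by (auto simp: AE_lebesgue_on_negligible_iff)
  obtain N1 where N1: "negligible N1" "\<And>t. t \<in> {0..T} - N1 \<Longrightarrow> \<exists>e. (z has_vector_derivative e) (at t within {0..T})"
    using lipschitz_differentiable_ae[OF zlip] T by (meson less_imp_le)
  have "\<exists>d\<in>F_incl U f g (\<xi> t). (\<xi> has_vector_derivative d) (at t within {0..T})"
    \<comment> \<open>Removing the endpoints turns derivatives within \<open>{0..T}\<close> into
      two-sided ones.\<close>
    if t: "t \<in> {0..T} - (N \<union> N1 \<union> {0, T})" for t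
  proof -
    have t': "0 < t" "t < T" "t \<in> {0..T}" using t by auto
    define \<gamma> where "\<gamma> = g (w t, u t)"
    have dw: "(w has_vector_derivative (f (w t, u t), \<gamma>)) (at t within {0..T})" using N(2)[of t] t by (simp add: \<gamma>_def)
    have dx: "((\<lambda>t. fst (w t)) has_vector_derivative f (w t, u t)) (at t within {0..T})"
      using has_vector_derivative_fst[OF dw] by simp
    have dy: "(y has_vector_derivative \<gamma>) (at t within {0..T})"
      unfolding y_def[abs_def] using has_vector_derivative_snd[OF dw] by simp
    obtain e where e: "(z has_vector_derivative e) (at t within {0..T})" using N1(2)[of t] t by auto
    have "if z t = y t then e = max \<gamma> 0 else e = 0"
      unfolding z_def
    proof (rule max_over_derivative[OF ylip t'(1,2)])
      show "((\<lambda>t. max_over t y) has_real_derivative e) (at t)"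
        using e t' by (simp add: has_real_derivative_iff_has_vector_derivative at_within_Icc_at z_def[abs_def])
      show "(y has_real_derivative \<gamma>) (at t)"
        using dy t' by (simp add: has_real_derivative_iff_has_vector_derivative at_within_Icc_at)
    qed
    moreover have "y t \<le> z t"
      unfolding z_def
    proof (rule max_over_upper)
      show "continuous_on {0..t} y"
        using lipschitz_on_continuous_on[OF ylip] by (rule continuous_on_subset) (use t' in auto)
    qed (use t' in simp)
    ultimately obtain v where v: "v \<in> {0..1}" "e = max \<gamma> 0 * (1 - v * indicator {0..} (z t - y t))"
      by (cases "z t = y t") (auto intro: that[of 0] that[of 1])
    have "(\<xi> has_vector_derivative (f (w t, u t), \<gamma>, e)) (at t within {0..T})"
      unfolding \<xi>_def[abs_def] by (intro has_vector_derivative_Pair dx dy e)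
    moreover have "(f (w t, u t), \<gamma>, e) \<in> F_incl U f g (\<xi> t)"
      unfolding F_incl_iff
      by (rule bexI[OF _ w(3)[OF t'(3)]], rule bexI[OF _ v(1)]) (use v in \<open>simp add: \<xi>_def y_def \<gamma>_def\<close>)
    ultimately show ?thesis by blast
  qed
  moreover have "negligible (N \<union> N1 \<union> {0, T})" using N N1 by simp
  ultimately have "AE t in lebesgue_on {0..T}. \<exists>d\<in>F_incl U f g (\<xi> t). (\<xi> has_vector_derivative d) (at t within {0..T})"
    unfolding AE_lebesgue_on_negligible_iff[OF sets_lebesgue_Icc] by blast
  moreover have "\<xi> 0 = (x0, y0, y0)"
    using w(1) by (simp add: \<xi>_def y_def z_def max_over_def)
  ultimately have "\<xi> \<in> S_l D U f g T x0 y0"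
    using ac w(2) unfolding S_l_def by (simp add: \<xi>_def y_def)
  then show ?thesis by (simp add: \<xi>_def[abs_def] y_def[abs_def] z_def)
qed

section \<open>Equality of the two optimal values and transfer of minimisers\<close>

theorem proposition4p1:
  fixes D :: "((real^'n) \<times> real) set"
    and U :: "(real^'p) set"
    and f :: "((real^'n) \<times> real) \<times> (real^'p) \<Rightarrow> real^'n"
    and g :: "((real^'n) \<times> real) \<times> (real^'p) \<Rightarrow> real"
    and T :: real and x0 :: "real^'n" and y0 :: real
  assumes domain: "open D" "connected D" "D \<noteq> {}"
    and U_nonempty: "U \<noteq> {}"
    and invariant: "invariant_domain D U f g"
    and A1_compact: "compact U"
    and A1_C1: "C1_on (D \<times> U) f" "C1_on (D \<times> U) g"
    and A1_growth: "\<exists>C>0. \<forall>x y u. (x, y) \<in> D \<longrightarrow> u \<in> U \<longrightarrow>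
      norm (f ((x, y), u)) + \<bar>g ((x, y), u)\<bar> \<le> C * (1 + norm x + \<bar>y\<bar>)"
    and A2: "\<forall>x y. (x, y) \<in> D \<longrightarrow> convex (\<Union>u\<in>U. {(f ((x, y), u), g ((x, y), u))})"
    and T_pos: "T > 0"
    and init: "(x0, y0) \<in> D"
  shows "(\<exists>\<xi>. optimal_P3 D U f g T x0 y0 \<xi>) \<and>
    (\<forall>x y z. optimal_P3 D U f g T x0 y0 (\<lambda>t. (x t, y t, z t)) \<longrightarrow>
       z T = max_over T y \<and>
       (\<exists>u. optimal_P D U f g T (x0, y0) u (\<lambda>t. (x t, y t))))"
proof -
  define F where "F p = (f p, g p)" for p
  obtain C where C: "C > 0" "\<And>x y u. (x, y) \<in> D \<Longrightarrow> u \<in> U \<Longrightarrow>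
      norm (f ((x, y), u)) + \<bar>g ((x, y), u)\<bar> \<le> C * (1 + norm x + \<bar>y\<bar>)"
    using A1_growth by blast
  \<comment> \<open>Pairs carry the Euclidean norm, for which \<open>norm x + \<bar>y\<bar>\<close>
    is at most twice the norm of the pair; hence the doubled constant.\<close>
  interpret control_system D U F "2 * C"
  proof
    show "continuous_on (D \<times> U) F"
      unfolding F_def using A1_C1 by (intro continuous_on_Pair C1_on_imp_continuous_on)
    show "norm (F (w, u)) \<le> 2 * C * (1 + norm w)" if "w \<in> D" "u \<in> U" for w u
    proof -
      have "norm (F (w, u)) \<le> norm (f (w, u)) + \<bar>g (w, u)\<bar>"
        using norm_Pair_le[of "f (w, u)" "g (w, u)"] by (simp add: F_def)
      also have "\<dots> \<le> C * (1 + norm (fst w) + norm (snd w))"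
        using C(2)[of "fst w" "snd w" u] that by simp
      also have "\<dots> \<le> C * (2 + 2 * norm w)"
        using norm_fst_plus_norm_snd_le[of w] C(1) by (intro mult_left_mono) auto
      finally show ?thesis by (simp add: algebra_simps)
    qed
    show "convex ((\<lambda>u. F (w, u)) ` U)" if "w \<in> D" for w
      using A2 that by (cases w) (auto simp: F_def UNION_singleton_eq_range)
  qed (use domain U_nonempty A1_compact C in auto)
  have traj: "trajectory \<tau> u w \<longleftrightarrow> u \<in> controls U \<tau> \<and> satisfies_control_ode f g \<tau> u w" for \<tau> u w
    by (auto simp: trajectory_def controls_def satisfies_control_ode_def F_def)
  interpret invariant_control_system D U F "2 * C"
    by standard (use invariant in \<open>auto simp: traj invariant_domain_def\<close>)
  define A where "A = admissible_pairs D U f g T (x0, y0)"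
  have A: "(u, w) \<in> A \<longleftrightarrow> trajectory T u w \<and> (\<forall>t\<in>{0..T}. w t \<in> D) \<and> w 0 = (x0, y0)" for u w
    by (auto simp: A_def admissible_pairs_def traj)
  define J where "J w = max_over T (\<lambda>t. snd (w t))" for w :: "real \<Rightarrow> (real^'n) \<times> real"
  have Acont: "continuous_on {0..T} (\<lambda>t. snd (w t))" if "(u, w) \<in> A" for u w
    using that abs_continuous_imp_continuous_on by (auto simp: A trajectory_def intro!: continuous_on_snd)
  \<comment> \<open>The value at time 0 bounds every maximum from below, so the infimum is
    finite.\<close>
  have J_lower: "y0 \<le> J w" if "(u, w) \<in> A" for u w
    using max_over_upper[OF Acont[OF that], of 0] that T_pos by (simp add: A J_def)
  have ne: "A \<noteq> {}"
    using trajectory_exists[OF T_pos init] A by (metis empty_iff)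
  define m where "m = Inf (J ` snd ` A)"
  have bdd: "bdd_below (J ` snd ` A)" using J_lower by (intro bdd_belowI[of _ y0]) auto
  have m_le: "m \<le> J w" if "(u, w) \<in> A" for u w
    unfolding m_def using that bdd by (intro cInf_lower) force+
  have "\<exists>uw\<in>A. J (snd uw) < m + 1 / real (Suc k)" for k
  proof -
    have "m < m + 1 / real (Suc k)" by simp
    then obtain j where "j \<in> J ` snd ` A" "j < m + 1 / real (Suc k)"
      using cInf_lessD[of "J ` snd ` A"] ne unfolding m_def by blast
    then show ?thesis by blast
  qed
  then obtain uw where uw: "\<And>k. uw k \<in> A" "\<And>k. J (snd (uw k)) < m + 1 / real (Suc k)" by metis
  define us where "us k = fst (uw k)" for k
  define ws where "ws k = snd (uw k)" for k
  have usws: "(us k, ws k) \<in> A" "J (ws k) < m + 1 / real (Suc k)" for k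
    using uw by (simp_all add: us_def ws_def)
  have "ws k 0 = (x0, y0)" "trajectory T (us k) (ws k)" "t \<in> {0..T} \<Longrightarrow> ws k t \<in> D" for k t
    using usws(1) A by auto
  then obtain v u r where v: "trajectory T u v" "v 0 = (x0, y0)" "\<And>t. t \<in> {0..T} \<Longrightarrow> v t \<in> D"
    and r: "strict_mono (r :: nat \<Rightarrow> nat)"
    and unif: "\<And>e. e > 0 \<Longrightarrow> \<exists>n. \<forall>k\<ge>n. \<forall>t\<in>{0..T}. dist (ws (r k) t) (v t) < e"
    using trajectory_limit[where w = ws and u = us, OF T_pos init] by metis
  have vA: "(u, v) \<in> A" using v A by blast
  \<comment> \<open>The maximum is lower semicontinuous: each value of the limit is a limit of
    values bounded by the maxima of the minimising sequence.\<close>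
  have "snd (v t) \<le> m" if t: "t \<in> {0..T}" for t
  proof -
    have "(\<lambda>k. ws (r k) t) \<longlonglongrightarrow> v t" unfolding lim_sequentially using unif t by blast
    then have lim1: "(\<lambda>k. snd (ws (r k) t)) \<longlonglongrightarrow> snd (v t)" by (rule tendsto_snd)
    have "(\<lambda>k. m + 1 / real (Suc k)) \<longlonglongrightarrow> m + 0" by (intro tendsto_intros LIMSEQ_Suc[OF lim_1_over_n])
    then have lim2: "(\<lambda>k. m + 1 / real (Suc (r k))) \<longlonglongrightarrow> m" using LIMSEQ_subseq_LIMSEQ[OF _ r] by (fastforce simp: o_def)
    have "snd (ws (r k) t) \<le> m + 1 / real (Suc (r k))" for k
      using max_over_upper[OF Acont[OF usws(1)] t, of "r k"] usws(2)[of "r k"] by (simp add: J_def)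
    then show ?thesis using LIMSEQ_le[OF lim1 lim2] by blast
  qed
  then have "J v \<le> m" unfolding J_def by (intro max_over_least) (use T_pos in auto)
  then have Jv: "J v = m" using m_le[OF vA] by simp
  have lower: "\<exists>u'. (u', \<lambda>t. (fst (\<xi> t), fst (snd (\<xi> t)))) \<in> A" if \<xi>: "\<xi> \<in> S_l D U f g T x0 y0" for \<xi>
  proof -
    define w where "w t = (fst (\<xi> t), fst (snd (\<xi> t)))" for t
    have ac: "abs_continuous_on 0 T \<xi>" and wD: "\<And>t. t \<in> {0..T} \<Longrightarrow> w t \<in> D" and w0: "w 0 = (x0, y0)"
      using \<xi> by (auto simp: S_l_def w_def case_prod_unfold)
    obtain N where N: "negligible N" "\<And>t. t \<in> {0..T} - N \<Longrightarrow>
        \<exists>d\<in>F_incl U f g (\<xi> t). (\<xi> has_vector_derivative d) (at t within {0..T})"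
      using \<xi> unfolding S_l_def by (auto simp: AE_lebesgue_on_negligible_iff)
    have acw: "abs_continuous_on 0 T w"
    proof (rule abs_continuous_on_compare[OF ac])
      fix s t
      have "dist (w s) (w t) \<le> dist (fst (\<xi> s)) (fst (\<xi> t)) + dist (fst (snd (\<xi> s))) (fst (snd (\<xi> t)))"
        unfolding w_def dist_Pair_Pair by (rule sqrt_sum_squares_le_sum) auto
      also have "dist (fst (\<xi> s)) (fst (\<xi> t)) \<le> dist (\<xi> s) (\<xi> t)" by (rule dist_fst_le)
      also have "dist (fst (snd (\<xi> s))) (fst (snd (\<xi> t))) \<le> dist (\<xi> s) (\<xi> t)"
        by (meson dist_fst_le dist_snd_le order_trans)
      finally show "dist (w s) (w t) \<le> 2 * dist (\<xi> s) (\<xi> t)" by simp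
    qed
    have "w t \<in> D \<and> (\<exists>u\<in>U. (w has_vector_derivative F (w t, u)) (at t within {0..T}))"
      if t: "t \<in> {0..T} - N" for t
    proof -
      obtain d where d: "d \<in> F_incl U f g (\<xi> t)" "(\<xi> has_vector_derivative d) (at t within {0..T})"
        using N(2)[OF t] by blast
      obtain u where u: "u \<in> U" "fst d = f (w t, u)" "fst (snd d) = g (w t, u)"
        using d(1) unfolding F_incl_iff w_def by force
      have "(w has_vector_derivative (fst d, fst (snd d))) (at t within {0..T})"
        unfolding w_def[abs_def]
        by (intro has_vector_derivative_Pair has_vector_derivative_fst has_vector_derivative_snd d(2))
      then show ?thesis using u wD t by (auto simp: F_def)
    qed
    then obtain u' where "trajectory T u' w" using trajectory_of_inclusion[OF acw N(1)] by blast
    then have "(u', w) \<in> A" using wD w0 A by blast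
    then show ?thesis unfolding w_def[abs_def] by blast
  qed
  have upper: "m \<le> max_over T (\<lambda>t. fst (snd (\<xi> t)))" if "\<xi> \<in> S_l D U f g T x0 y0" for \<xi>
    using lower[OF that] m_le by (fastforce simp: J_def)
  obtain L where "L-lipschitz_on {0..T} v"
    using trajectory_lipschitz[OF v(1,3)] by blast
  then have vS: "(\<lambda>t. (fst (v t), snd (v t), max_over t (\<lambda>s. snd (v s)))) \<in> S_l D U f g T x0 y0"
    by (rule trajectory_with_running_max_in_S_l[OF vA[unfolded A_def] _ T_pos])
  \<comment> \<open>\<open>m\<close> is also the value of the second problem: the lifted minimiser
    \<open>vS\<close> attains it, and \<open>upper\<close> with \<open>S_l_max_le\<close> shows that
    nothing lies below it.\<close>
  have opt_iff: "optimal_P3 D U f g T x0 y0 \<xi> \<longleftrightarrow> \<xi> \<in> S_l D U f g T x0 y0 \<and> snd (snd (\<xi> T)) \<le> m" for \<xi>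
  proof
    assume "optimal_P3 D U f g T x0 y0 \<xi>"
    then show "\<xi> \<in> S_l D U f g T x0 y0 \<and> snd (snd (\<xi> T)) \<le> m"
      using vS Jv by (fastforce simp: optimal_P3_def is_arg_min_def J_def not_less)
  next
    assume *: "\<xi> \<in> S_l D U f g T x0 y0 \<and> snd (snd (\<xi> T)) \<le> m"
    have "snd (snd (\<xi> T)) \<le> snd (snd (\<zeta> T))" if "\<zeta> \<in> S_l D U f g T x0 y0" for \<zeta>
      using * upper[OF that] S_l_max_le[OF that T_pos] by linarith
    then show "optimal_P3 D U f g T x0 y0 \<xi>" using * by (auto simp: optimal_P3_def is_arg_min_def not_less)
  qed
  have "optimal_P3 D U f g T x0 y0 (\<lambda>t. (fst (v t), snd (v t), max_over t (\<lambda>s. snd (v s))))"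
    using vS Jv by (simp add: opt_iff J_def)
  moreover have "z T = max_over T y \<and> (\<exists>u. optimal_P D U f g T (x0, y0) u (\<lambda>t. (x t, y t)))"
    if "optimal_P3 D U f g T x0 y0 (\<lambda>t. (x t, y t, z t))" for x y z
  proof -
    have S: "(\<lambda>t. (x t, y t, z t)) \<in> S_l D U f g T x0 y0" and le: "z T \<le> m"
      using that by (simp_all add: opt_iff)
    \<comment> \<open>A squeeze: \<open>m <= max_over T y <= z T <= m\<close>.\<close>
    have eq: "max_over T y = m" "z T = m"
      using upper[OF S] S_l_max_le[OF S T_pos] le by simp_all
    obtain u' where u': "(u', \<lambda>t. (x t, y t)) \<in> A" using lower[OF S] by auto
    have "optimal_P D U f g T (x0, y0) u' (\<lambda>t. (x t, y t))"
      unfolding optimal_P_def is_arg_min_def A_def[symmetric]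
      using u' m_le eq by (fastforce simp: J_def not_less)
    then show ?thesis using eq by blast
  qed
  ultimately show ?thesis by blast
qed

end
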